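(* Take a finite-dimensional quantum system consisting of a subsystem $S$ and an environment $B$, with Hilbert space $\mathcal{H}_S\otimes\mathcal{H}_B$, evolving via a time-independent Hamiltonian that has $d_E$ distinct energies. For any $\varepsilon>0$ and time $T>0$, the trace distance between the state $\rho_S(t)$ of the subsystem at time $t$ and its infinite-time average $\omega_S=\langle\rho_S(t)\rangle_\infty$, averaged over the interval $[0,T]$, is bounded above by $$\left\langle D(\rho_S(t),\omega_S)\right\rangle_T\le\frac12\sqrt{\frac{d_S^2}{d_{\rm eff}}\,\frac{5\pi N(\varepsilon)}{2}\left[\frac34+\frac1{\varepsilon T}\right]},$$ where $d_S=\dim\mathcal{H}_S$ is the dimension of the subsystem.
   Context: The Hamiltonian on $\mathcal{H}_S\otimes\mathcal{H}_B$ is $H=\sum_{n=1}^{d_E}E_nP_n$ with distinct energies $E_n$ and $P_n$ the projector onto the eigenspace of energy $E_n$; $\rho(t)=e^{-iHt}\rho(0)e^{iHt}$ with $\rho(0)$ an arbitrary density operator on the whole system, and $\rho_S(t)=\mathrm{tr}_B\,\rho(t)$. $\langle f(t)\rangle_T=\frac1T\int_0^Tf(t)\,dt$ and $\langle f(t)\rangle_\infty=\lim_{T\to\infty}\langle f(t)\rangle_T$. The trace distance is $D(\rho,\sigma)=\frac12\mathrm{tr}|\rho-\sigma|$. $d_{\rm eff}=1/\sum_n(\mathrm{tr}[P_n\rho(0)])^2$ (for the whole system). For each pair $\alpha=(i,j)$ with $i\ne j$, $G_\alpha=E_i-E_j$, and $N(\varepsilon)=\max_E|\{\alpha:G_\alpha\in[E,E+\varepsilon)\}|$.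 *)

theory Defs
  imports "HOL-Analysis.Analysis"
begin

text \<open>
  After a choice of orthonormal bases, a system with Hilbert space of dimension \<open>CARD('n)\<close> is
  \<open>complex ^ 'n\<close> and its operators are the matrices \<open>complex ^ 'n ^ 'n\<close>.  The product type
  \<open>'s \<times> 'b\<close> indexes the product basis of the tensor product of the spaces indexed by
  \<open>'s\<close> and \<open>'b\<close>.
\<close>

subsection \<open>Operators\<close>

definition ctranspose :: "complex ^ 'm ^ 'n \<Rightarrow> complex ^ 'n ^ 'm" where
  "ctranspose A = (\<chi> i j. cnj (A $ j $ i))"

definition hermitian :: "complex ^ 'n ^ 'n \<Rightarrow> bool" where
  "hermitian A \<longleftrightarrow> ctranspose A = A"

definition cinner :: "complex ^ 'n \<Rightarrow> complex ^ 'n \<Rightarrow> complex" where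
  "cinner v w = (\<Sum>i\<in>UNIV. cnj (v $ i) * w $ i)"

text \<open>For hermitian \<open>A\<close> the quadratic form is real-valued, so taking the real part loses nothing.\<close>

definition positive_semidefinite :: "complex ^ 'n ^ 'n \<Rightarrow> bool" where
  "positive_semidefinite A \<longleftrightarrow> hermitian A \<and> (\<forall>v. 0 \<le> Re (cinner v (A *v v)))"

definition density_operator :: "complex ^ 'n ^ 'n \<Rightarrow> bool" where
  "density_operator \<rho> \<longleftrightarrow> positive_semidefinite \<rho> \<and> trace \<rho> = 1"

definition mat_sqrt :: "complex ^ 'n ^ 'n \<Rightarrow> complex ^ 'n ^ 'n" where
  "mat_sqrt A = (THE B. positive_semidefinite B \<and> B ** B = A)"

definition mat_abs :: "complex ^ 'n ^ 'n \<Rightarrow> complex ^ 'n ^ 'n" where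
  "mat_abs A = mat_sqrt (ctranspose A ** A)"

definition trace_distance :: "complex ^ 'n ^ 'n \<Rightarrow> complex ^ 'n ^ 'n \<Rightarrow> real" where
  "trace_distance \<rho> \<sigma> = Re (trace (mat_abs (\<rho> - \<sigma>))) / 2"

definition partial_trace_B :: "complex ^ ('s::finite \<times> 'b::finite) ^ ('s \<times> 'b) \<Rightarrow> complex ^ 's ^ 's" where
  "partial_trace_B \<rho> = (\<chi> i j. \<Sum>b\<in>UNIV. \<rho> $ (i, b) $ (j, b))"

text \<open>
  The library's \<open>exp\<close> and \<open>^\<close> are not available here: multiplication
  \<open>*\<close> on the vector type is componentwise, the matrix product is \<open>**\<close>.
\<close>

definition mat_pow :: "complex ^ 'n ^ 'n \<Rightarrow> nat \<Rightarrow> complex ^ 'n ^ 'n" where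
  "mat_pow A k = (((**) A) ^^ k) (mat 1)"

definition mat_exp :: "complex ^ 'n ^ 'n \<Rightarrow> complex ^ 'n ^ 'n" where
  "mat_exp A = (\<Sum>k. mat_pow A k /\<^sub>R fact k)"

subsection \<open>Hamiltonian and dynamics\<close>

definition eigenspace :: "complex ^ 'n ^ 'n \<Rightarrow> real \<Rightarrow> (complex ^ 'n) set" where
  "eigenspace H e = {v. H *v v = complex_of_real e *s v}"

text \<open>The energies are the eigenvalues of \<open>H\<close>, which are real for hermitian \<open>H\<close>.\<close>

definition energies :: "complex ^ 'n ^ 'n \<Rightarrow> real set" where
  "energies H = {e. eigenspace H e \<noteq> {0}}"

definition orthogonal_projector_onto ::
    "complex ^ 'n ^ 'n \<Rightarrow> (complex ^ 'n) set \<Rightarrow> bool" where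
  "orthogonal_projector_onto P V \<longleftrightarrow> hermitian P \<and> P ** P = P \<and> range (\<lambda>v. P *v v) = V"

text \<open>
  \<open>E 1, \<dots>, E d\<close> enumerate without repetition \<^emph>\<open>all\<close> energies of \<open>H\<close>.  Exhaustiveness matters
  because the zero energy, if present, leaves no trace in the sum for \<open>H\<close>.
\<close>

definition hamiltonian_decomposition ::
    "complex ^ 'n ^ 'n \<Rightarrow> nat \<Rightarrow> (nat \<Rightarrow> real) \<Rightarrow> (nat \<Rightarrow> complex ^ 'n ^ 'n) \<Rightarrow> bool" where
  "hamiltonian_decomposition H d E P \<longleftrightarrow>
     hermitian H \<and>
     bij_betw E {1..d} (energies H) \<and>
     (\<forall>n\<in>{1..d}. orthogonal_projector_onto (P n) (eigenspace H (E n))) \<and>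
     H = (\<Sum>n=1..d. E n *\<^sub>R P n)"

definition evolved_state ::
    "complex ^ 'n ^ 'n \<Rightarrow> complex ^ 'n ^ 'n \<Rightarrow> real \<Rightarrow> complex ^ 'n ^ 'n" where
  "evolved_state H \<rho>0 t =
     mat_exp (map_matrix (\<lambda>h. - \<i> * h * of_real t) H) ** \<rho>0 **
     mat_exp (map_matrix (\<lambda>h. \<i> * h * of_real t) H)"

definition subsystem_state ::
    "complex ^ ('s::finite \<times> 'b::finite) ^ ('s \<times> 'b) \<Rightarrow> complex ^ ('s \<times> 'b) ^ ('s \<times> 'b) \<Rightarrow> real \<Rightarrow>
     complex ^ 's ^ 's" where
  "subsystem_state H \<rho>0 t = partial_trace_B (evolved_state H \<rho>0 t)"

definition time_average :: "(real \<Rightarrow> 'a::real_normed_vector) \<Rightarrow> real \<Rightarrow> 'a" where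
  "time_average f T = integral {0..T} f /\<^sub>R T"

definition infinite_time_average :: "(real \<Rightarrow> 'a::real_normed_vector) \<Rightarrow> 'a" where
  "infinite_time_average f = Lim at_top (time_average f)"

subsection \<open>Effective dimension and gap counting\<close>

text \<open>The traces below are real for hermitian \<open>P n\<close> and \<open>\<rho>0\<close>.\<close>

definition effective_dimension ::
    "nat \<Rightarrow> (nat \<Rightarrow> complex ^ 'n ^ 'n) \<Rightarrow> complex ^ 'n ^ 'n \<Rightarrow> real" where
  "effective_dimension d P \<rho>0 = 1 / (\<Sum>n=1..d. (Re (trace (P n ** \<rho>0)))\<^sup>2)"

definition gap_indices :: "nat \<Rightarrow> (nat \<times> nat) set" where
  "gap_indices d = {(i, j). i \<in> {1..d} \<and> j \<in> {1..d} \<and> i \<noteq> j}"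

definition energy_gap :: "(nat \<Rightarrow> real) \<Rightarrow> nat \<times> nat \<Rightarrow> real" where
  "energy_gap E \<alpha> = E (fst \<alpha>) - E (snd \<alpha>)"

text \<open>The maximum runs over all real \<open>e\<close>; the cardinalities are bounded, so it is attained.\<close>

definition max_gap_count :: "nat \<Rightarrow> (nat \<Rightarrow> real) \<Rightarrow> real \<Rightarrow> nat" where
  "max_gap_count d E \<epsilon> =
     Max (range (\<lambda>e::real. card {\<alpha> \<in> gap_indices d. energy_gap E \<alpha> \<in> {e..<e + \<epsilon>}}))"

end

(*
  Writing X_ij = tr_B (P_i rho P_j), the deviation of the subsystem from its average is the
  trigonometric sum of the X_ij exp(-i G t) over the energy gaps G = E_i - E_j with i \<noteq> j.  The trace
  norm is at most sqrt d_S times the Frobenius norm, so by Jensen's inequality it suffices to bound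
  the mean square of this sum over [0,T].  Majorising the indicator of [0,T] by a Gaussian turns the
  mean square into a quadratic form in the X_ij whose kernel is Gaussian in the differences of gaps;
  sorting the gaps into windows of length epsilon, each containing at most N(epsilon) of them, bounds
  the row sums of the kernel by (5 pi N(epsilon) / 2) (3/4 + 1/(epsilon T)).  Finally the sum of the
  squared Frobenius norms of the X_ij is at most d_S / d_eff.
*)

theory Submission
  imports Defs "HOL-Probability.Characteristic_Functions"
begin

subsection \<open>Positive square roots and the trace distance\<close>

lemma of_real_vec_scale: "complex_of_real r *s v = r *\<^sub>R v"
  by (simp add: vec_eq_iff complex_eq_iff)

lemma cinner_add_right: "cinner u (v + w) = cinner u v + cinner u w"
  by (simp add: cinner_def algebra_simps sum.distrib)

lemma cinner_diff_right: "cinner u (v - w) = cinner u v - cinner u w"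
  by (simp add: cinner_def algebra_simps sum_subtractf)

lemma cinner_scale_right: "cinner u (c *s v) = c * cinner u v"
  by (simp add: cinner_def algebra_simps sum_distrib_left)

lemma cinner_scale_left: "cinner (c *s u) v = cnj c * cinner u v"
  by (simp add: cinner_def algebra_simps sum_distrib_left)

lemma cinner_scaleR_right: "cinner u (r *\<^sub>R v) = of_real r * cinner u v"
  by (simp add: cinner_scale_right flip: of_real_vec_scale)

lemma cinner_zero_right [simp]: "cinner u 0 = 0"
  by (simp add: cinner_def)

lemma cinner_sum_right: "cinner u (\<Sum>s\<in>S. f s) = (\<Sum>s\<in>S. cinner u (f s))"
  by (induction S rule: infinite_finite_induct) (auto simp: cinner_add_right)

lemma cnj_cinner: "cnj (cinner u v) = cinner v u"
  by (simp add: cinner_def mult.commute)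

lemma Re_cinner: "Re (cinner u v) = u \<bullet> v"
  by (simp add: cinner_def inner_vec_def inner_complex_def)

lemma cinner_self: "cinner v v = of_real ((norm v)\<^sup>2)"
proof -
  have "Im (cinner v v) = 0"
    by (metis Reals_cnj_iff cnj_cinner complex_is_Real_iff)
  then show ?thesis
    by (simp add: complex_eq_iff Re_cinner power2_norm_eq_inner)
qed

lemma cinner_adjoint: "cinner v (A *v w) = cinner (ctranspose A *v v) w"
proof -
  have "cinner v (A *v w) = (\<Sum>i\<in>UNIV. \<Sum>j\<in>UNIV. cnj (v $ i) * (A $ i $ j * w $ j))"
    by (simp add: cinner_def matrix_vector_mult_def sum_distrib_left)
  also have "\<dots> = (\<Sum>j\<in>UNIV. \<Sum>i\<in>UNIV. cnj (v $ i) * (A $ i $ j * w $ j))"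
    by (rule sum.swap)
  also have "\<dots> = cinner (ctranspose A *v v) w"
    by (simp add: cinner_def matrix_vector_mult_def ctranspose_def sum_distrib_left
        sum_distrib_right mult_ac)
  finally show ?thesis .
qed

lemma cinner_hermitian: "hermitian A \<Longrightarrow> cinner v (A *v w) = cinner (A *v v) w"
  by (simp add: cinner_adjoint hermitian_def)

lemma selfadjoint_eigenvector:
  fixes f :: "'a::euclidean_space \<Rightarrow> 'a"
  assumes lin: "linear f" and adj: "\<And>x y. f x \<bullet> y = x \<bullet> f y"
    and V: "subspace V" "f ` V \<subseteq> V" "V \<noteq> {0}"
  obtains v e where "v \<in> V" "norm v = 1" "f v = e *\<^sub>R v"
proof -
  obtain v0 where v0: "v0 \<in> V" "v0 \<noteq> 0"
    using V(1,3) subspace_0 by blast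
  let ?K = "V \<inter> sphere 0 1"
  have "v0 /\<^sub>R norm v0 \<in> ?K"
    using v0 V(1) by (simp add: subspace_scale)
  then have "?K \<noteq> {}" by blast
  moreover have "compact ?K"
    by (simp add: V(1) closed_Int_compact closed_subspace)
  moreover have "continuous_on ?K (\<lambda>y. y \<bullet> f y)"
    by (intro continuous_intros linear_continuous_on linear_conv_bounded_linear[THEN iffD1] lin)
  ultimately obtain v where v: "v \<in> ?K" and max: "\<And>y. y \<in> ?K \<Longrightarrow> y \<bullet> f y \<le> v \<bullet> f v"
    using continuous_attains_sup by meson
  define e where "e = v \<bullet> f v"
  have vv: "v \<bullet> v = 1" "v \<in> V" using v by (auto simp: dot_square_norm)
  define g where "g x = e *\<^sub>R x - f x" for x
  have glin: "linear g"
    unfolding g_def by (intro linear_compose_sub lin linear_compose_scale_right linear_ident)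
  have gadj: "g x \<bullet> y = x \<bullet> g y" for x y
    by (simp add: g_def adj inner_diff_left inner_diff_right)
  have gV: "g x \<in> V" if "x \<in> V" for x
    unfolding g_def using that V by (auto intro!: subspace_diff subspace_scale)
  have nonneg: "0 \<le> w \<bullet> g w" if "w \<in> V" for w
  proof (cases "w = 0")
    case False
    let ?u = "w /\<^sub>R norm w"
    have "?u \<in> ?K" using that False V(1) by (simp add: subspace_scale)
    then have "?u \<bullet> f ?u \<le> e" using max e_def by blast
    moreover have "f ?u = f w /\<^sub>R norm w" by (simp add: lin linear_scale)
    ultimately have "(w \<bullet> f w) / (norm w)\<^sup>2 \<le> e"
      by (simp add: power2_eq_square divide_inverse mult_ac)
    then have "w \<bullet> f w \<le> e * (norm w)\<^sup>2"
      using False by (simp add: pos_divide_le_eq)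
    then show ?thesis
      by (simp add: g_def inner_diff_right dot_square_norm)
  qed simp
  define w where "w = g v"
  have wV: "w \<in> V" using gV vv w_def by blast
  define b c where "b = w \<bullet> w" and "c = w \<bullet> g w"
  have c: "c \<ge> 0" using nonneg wV c_def by blast
  have gvv: "v \<bullet> g v = 0"
    by (simp add: g_def inner_diff_right vv e_def)
  have quad: "0 \<le> 2 * t * b + t\<^sup>2 * c" for t
  proof -
    have "0 \<le> (v + t *\<^sub>R w) \<bullet> g (v + t *\<^sub>R w)"
      using nonneg V(1) vv wV by (simp add: subspace_add subspace_scale)
    also have "g (v + t *\<^sub>R w) = w + t *\<^sub>R g w"
      by (simp add: glin linear_add linear_scale w_def)
    also have "(v + t *\<^sub>R w) \<bullet> (w + t *\<^sub>R g w) = v \<bullet> w + t * (v \<bullet> g w) + t * b + t\<^sup>2 * c"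
      by (simp add: inner_add_left inner_add_right b_def c_def algebra_simps power2_eq_square)
    also have "v \<bullet> g w = b"
      by (simp add: b_def w_def flip: gadj)
    also have "v \<bullet> w = 0" using gvv w_def by simp
    finally show ?thesis by (simp add: mult_ac)
  qed
  have "b = 0"
  proof (rule ccontr)
    assume "b \<noteq> 0"
    have "0 \<le> 2 * (- b / (c + 1)) * b + (- b / (c + 1))\<^sup>2 * c" by (rule quad)
    also have "\<dots> = b\<^sup>2 * (c - 2 * (c + 1)) / (c + 1)\<^sup>2"
      using c by (simp add: divide_simps) (simp add: algebra_simps power2_eq_square)
    also have "\<dots> < 0"
      using c \<open>b \<noteq> 0\<close> by (intro divide_neg_pos mult_pos_neg) auto
    finally show False by simp
  qed
  then have "f v = e *\<^sub>R v" by (simp add: b_def w_def g_def)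
  then show ?thesis using that[of v e] vv v by simp
qed

definition orthonormal_eigenset where
  "orthonormal_eigenset A e S \<longleftrightarrow>
     finite S \<and> (\<forall>s\<in>S. \<forall>t\<in>S. cinner s t = (if s = t then 1 else 0)) \<and>
     (\<forall>s\<in>S. A *v s = complex_of_real (e s) *s s)"

lemma hermitian_eigenbasis:
  fixes A :: "complex ^ 'n ^ 'n"
  assumes A: "hermitian A"
  obtains S e where "orthonormal_eigenset A e S" "\<And>v. v = (\<Sum>s\<in>S. cinner s v *s s)"
proof -
  let ?Q = "\<lambda>S. \<exists>e. orthonormal_eigenset A e S"
  have bound: "card S \<le> DIM(complex ^ 'n)" if Q: "?Q S" for S
  proof -
    obtain e where S: "orthonormal_eigenset A e S" using Q by blast
    then have 0: "0 \<notin> S"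
      unfolding orthonormal_eigenset_def by (metis cinner_zero_right zero_neq_one)
    have "pairwise orthogonal S"
      using S unfolding pairwise_def orthogonal_def orthonormal_eigenset_def
      by (metis Re_cinner zero_complex.simps(1))
    then have "independent S"
      using 0 pairwise_orthogonal_independent by blast
    then show ?thesis by (rule independent_bound[THEN conjunct2])
  qed
  have "?Q {}" by (simp add: orthonormal_eigenset_def)
  then obtain S where QS: "?Q S" and max: "\<And>R. ?Q R \<Longrightarrow> card R \<le> card S"
    using ex_has_greatest_nat[of ?Q "{}" card "Suc (DIM(complex ^ 'n))"] bound
    by (meson le_imp_less_Suc)
  then obtain e where S: "orthonormal_eigenset A e S" by blast
  then have fin: "finite S" by (simp add: orthonormal_eigenset_def)
  define V where "V = {v. \<forall>s\<in>S. cinner s v = 0}"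
  have "V = {0}"
  proof (rule ccontr)
    assume V0: "V \<noteq> {0}"
    have subV: "subspace V"
      by (auto simp: V_def subspace_def cinner_add_right cinner_scaleR_right)
    have AV: "(*v) A ` V \<subseteq> V"
    proof (clarsimp simp: V_def)
      fix v s assume "\<forall>s\<in>S. cinner s v = 0" "s \<in> S"
      then show "cinner s (A *v v) = 0"
        using S by (simp add: cinner_hermitian[OF A] orthonormal_eigenset_def cinner_scale_left)
    qed
    have adj: "(A *v x) \<bullet> y = x \<bullet> (A *v y)" for x y
      by (metis A cinner_hermitian Re_cinner)
    obtain v r where v: "v \<in> V" "norm v = 1" "A *v v = r *\<^sub>R v"
      using selfadjoint_eigenvector[OF matrix_vector_mul_linear adj subV AV V0] by metis
    have vS: "v \<notin> S"
      using v by (auto simp: V_def cinner_self)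
    have ort: "cinner s v = 0" "cinner v s = 0" if "s \<in> S" for s
    proof -
      show "cinner s v = 0" using v that V_def by blast
      then show "cinner v s = 0" by (metis cnj_cinner complex_cnj_zero)
    qed
    have "orthonormal_eigenset A (e(v := r)) (insert v S)"
      using S vS ort v unfolding orthonormal_eigenset_def
      by (auto simp: cinner_self of_real_vec_scale)
    then have "card (insert v S) \<le> card S" using max by blast
    then show False using vS fin by simp
  qed
  have "v = (\<Sum>s\<in>S. cinner s v *s s)" for v
  proof -
    have "v - (\<Sum>s\<in>S. cinner s v *s s) \<in> V"
      unfolding V_def
    proof (intro CollectI ballI)
      fix t assume t: "t \<in> S"
      have "cinner t (\<Sum>s\<in>S. cinner s v *s s) = (\<Sum>s\<in>S. if t = s then cinner s v else 0)"
        unfolding cinner_sum_right cinner_scale_right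
        using S t by (intro sum.cong) (auto simp: orthonormal_eigenset_def)
      then show "cinner t (v - (\<Sum>s\<in>S. cinner s v *s s)) = 0"
        using fin t by (simp add: cinner_diff_right)
    qed
    then show ?thesis using \<open>V = {0}\<close> by simp
  qed
  then show ?thesis using that S by blast
qed

lemma psd_sqrt_eigenvector:
  assumes C: "positive_semidefinite C" and s: "C *v (C *v s) = complex_of_real e *s s"
    and e: "0 \<le> e"
  shows "C *v s = complex_of_real (sqrt e) *s s"
proof -
  let ?r = "complex_of_real (sqrt e)"
  have hC: "hermitian C" using C positive_semidefinite_def by blast
  have rr: "?r * ?r = complex_of_real e"
    using e by (simp flip: of_real_mult)
  define w where "w = C *v s - ?r *s s"
  have "C *v w = C *v (C *v s) - ?r *s (C *v s)"
    by (simp add: w_def matrix_vector_mult_diff_distrib vector_scalar_commute)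
  also have "\<dots> = - ?r *s w"
    by (simp add: w_def s vec_eq_iff algebra_simps flip: rr)
  finally have Cw: "C *v w = - ?r *s w" .
  have "w = 0"
  proof (cases "e = 0")
    case True
    then have "w = C *v s" by (simp add: w_def)
    then have "cinner w w = cinner s (C *v (C *v s))"
      by (simp add: cinner_hermitian[OF hC])
    then show ?thesis using True by (simp add: s cinner_self)
  next
    case False
    have "0 \<le> Re (cinner w (C *v w))" using C positive_semidefinite_def by blast
    also have "\<dots> = - sqrt e * (norm w)\<^sup>2"
      unfolding Cw cinner_scale_right cinner_self by simp
    finally show ?thesis using False e
      by (simp add: mult_le_0_iff)
  qed
  then show ?thesis by (simp add: w_def)
qed

lemma psd_sqrt_exists_unique:
  fixes A :: "complex ^ 'n ^ 'n"
  assumes A: "positive_semidefinite A"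
  shows "\<exists>!B. positive_semidefinite B \<and> B ** B = A"
proof -
  have hA: "hermitian A" using A positive_semidefinite_def by blast
  obtain S e where S: "orthonormal_eigenset A e S"
    and exp: "\<And>v. v = (\<Sum>s\<in>S. cinner s v *s s)"
    using hermitian_eigenbasis[OF hA] by blast
  have fin: "finite S" and ort: "\<And>s t. s \<in> S \<Longrightarrow> t \<in> S \<Longrightarrow> cinner s t = (if s = t then 1 else 0)"
    and eig: "\<And>s. s \<in> S \<Longrightarrow> A *v s = complex_of_real (e s) *s s"
    using S by (auto simp: orthonormal_eigenset_def)
  have e: "0 \<le> e s" if "s \<in> S" for s
  proof -
    have "0 \<le> Re (cinner s (A *v s))" using A positive_semidefinite_def by blast
    then show ?thesis using that by (simp add: eig cinner_scale_right ort)
  qed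
  have eqI: "C *v v = D *v v" if "\<And>s. s \<in> S \<Longrightarrow> C *v s = D *v s" for C D :: "complex ^ 'n ^ 'n" and v
  proof -
    have *: "C *v v = (\<Sum>s\<in>S. cinner s v *s (C *v s))" for C :: "complex ^ 'n ^ 'n"
      by (subst exp[of v]) (simp add: vec.linear_sum[OF matrix_vector_mul_linear_gen] vector_scalar_commute)
    show ?thesis by (simp add: * that)
  qed
  define B :: "complex ^ 'n ^ 'n" where
    "B = (\<chi> i j. \<Sum>s\<in>S. complex_of_real (sqrt (e s)) * s $ i * cnj (s $ j))"
  have Bv: "B *v v = (\<Sum>s\<in>S. (complex_of_real (sqrt (e s)) * cinner s v) *s s)" for v
  proof -
    have "(B *v v) $ i = (\<Sum>s\<in>S. (complex_of_real (sqrt (e s)) * cinner s v) *s s) $ i" for i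
    proof -
      have "(B *v v) $ i = (\<Sum>j\<in>UNIV. \<Sum>s\<in>S. complex_of_real (sqrt (e s)) * s $ i * cnj (s $ j) * v $ j)"
        by (simp add: B_def matrix_vector_mult_def sum_distrib_right)
      also have "\<dots> = (\<Sum>s\<in>S. \<Sum>j\<in>UNIV. complex_of_real (sqrt (e s)) * s $ i * cnj (s $ j) * v $ j)"
        by (rule sum.swap)
      finally show ?thesis
        by (simp add: cinner_def sum_distrib_left sum_distrib_right mult_ac)
    qed
    then show ?thesis by (simp add: vec_eq_iff)
  qed
  have Bs: "B *v t = complex_of_real (sqrt (e t)) *s t" if t: "t \<in> S" for t
  proof -
    have "B *v t = (\<Sum>s\<in>S. if s = t then complex_of_real (sqrt (e t)) *s t else 0)"
      unfolding Bv by (rule sum.cong) (auto simp: ort t)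
    then show ?thesis using fin t by simp
  qed
  have "hermitian B"
    by (simp add: hermitian_def ctranspose_def B_def vec_eq_iff mult_ac)
  moreover have "0 \<le> Re (cinner v (B *v v))" for v
  proof -
    have "cinner v (B *v v) = (\<Sum>s\<in>S. complex_of_real (sqrt (e s) * (cmod (cinner s v))\<^sup>2))"
      unfolding Bv cinner_sum_right cinner_scale_right
      unfolding of_real_mult complex_norm_square cnj_cinner by (simp add: mult.assoc)
    then show ?thesis by (auto intro!: sum_nonneg mult_nonneg_nonneg e)
  qed
  moreover have "B ** B = A"
  proof -
    have "(B ** B) *v s = A *v s" if "s \<in> S" for s
      using that e by (simp add: Bs eig vector_scalar_commute vector_smult_assoc
          flip: matrix_vector_mul_assoc of_real_mult)
    then show ?thesis using eqI matrix_eq by blast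
  qed
  moreover have "C = B" if C: "positive_semidefinite C" "C ** C = A" for C
  proof -
    have "C *v s = B *v s" if "s \<in> S" for s
      using psd_sqrt_eigenvector[OF C(1), of s "e s"] that e
      by (simp add: Bs eig matrix_vector_mul_assoc C(2))
    then show ?thesis using eqI matrix_eq by blast
  qed
  ultimately show ?thesis
    unfolding positive_semidefinite_def by blast
qed

lemma mat_sqrt_psd:
  assumes "positive_semidefinite A"
  shows "positive_semidefinite (mat_sqrt A)" "mat_sqrt A ** mat_sqrt A = A"
proof -
  have "positive_semidefinite (mat_sqrt A) \<and> mat_sqrt A ** mat_sqrt A = A"
    unfolding mat_sqrt_def by (rule theI'[OF psd_sqrt_exists_unique[OF assms]])
  then show "positive_semidefinite (mat_sqrt A)" "mat_sqrt A ** mat_sqrt A = A"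
    by blast+
qed

lemma matrix_norm_square: "(norm A)\<^sup>2 = (\<Sum>i\<in>UNIV. \<Sum>j\<in>UNIV. (cmod (A $ i $ j))\<^sup>2)"
  for A :: "complex ^ 'm ^ 'n"
  by (simp add: norm_vec_def L2_set_def sum_nonneg)

lemma matrix_mult_nth: "(A ** B) $ i $ j = (\<Sum>k\<in>UNIV. A $ i $ k * B $ k $ j)"
  by (simp add: matrix_matrix_mult_def)

lemma ctranspose_ctranspose [simp]: "ctranspose (ctranspose A) = A"
  by (simp add: ctranspose_def)

lemma ctranspose_mult: "ctranspose (A ** B) = ctranspose B ** ctranspose A"
  by (simp add: vec_eq_iff ctranspose_def matrix_matrix_mult_def mult.commute)

lemma trace_ctranspose_mult: "trace (ctranspose A ** A) = of_real ((norm A)\<^sup>2)"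
proof -
  have "trace (ctranspose A ** A) = (\<Sum>j\<in>UNIV. \<Sum>i\<in>UNIV. of_real ((cmod (A $ i $ j))\<^sup>2))"
    unfolding trace_def matrix_mult_nth
    by (simp add: ctranspose_def complex_norm_square mult.commute del: of_real_power)
  also have "\<dots> = (\<Sum>i\<in>UNIV. \<Sum>j\<in>UNIV. of_real ((cmod (A $ i $ j))\<^sup>2))"
    by (rule sum.swap)
  finally show ?thesis by (simp add: matrix_norm_square)
qed

lemma psd_ctranspose_mult: "positive_semidefinite (ctranspose A ** A)"
proof -
  have "cinner v ((ctranspose A ** A) *v v) = cinner (A *v v) (A *v v)" for v
    by (metis cinner_adjoint ctranspose_ctranspose matrix_vector_mul_assoc)
  then show ?thesis
    by (simp add: positive_semidefinite_def hermitian_def ctranspose_mult cinner_self)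
qed

lemma Re_trace_le_norm: "Re (trace A) \<le> sqrt (real CARD('n)) * norm A"
  for A :: "complex ^ 'n ^ 'n"
proof -
  have "Re (A $ i $ i) \<le> 1 * norm (A $ i)" for i
    using complex_Re_le_cmod[of "A $ i $ i"] Finite_Cartesian_Product.norm_nth_le[of "A $ i" i]
    by linarith
  then have "Re (trace A) \<le> (\<Sum>i\<in>UNIV. 1 * norm (A $ i))"
    unfolding trace_def Re_sum by (rule sum_mono)
  also have "\<dots> \<le> L2_set (\<lambda>_. 1) (UNIV :: 'n set) * L2_set (\<lambda>i. norm (A $ i)) UNIV"
    using L2_set_mult_ineq[of "\<lambda>_. 1" "\<lambda>i. norm (A $ i)" UNIV]
    by (simp only: abs_one abs_norm_cancel)
  finally show ?thesis by (simp add: L2_set_def norm_vec_def)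
qed

lemma trace_distance_le_norm:
  "trace_distance \<rho> \<sigma> \<le> sqrt (real CARD('n)) * norm (\<rho> - \<sigma>) / 2"
  for \<rho> \<sigma> :: "complex ^ 'n ^ 'n"
proof -
  let ?A = "\<rho> - \<sigma>"
  let ?B = "mat_abs ?A"
  have B: "positive_semidefinite ?B" "?B ** ?B = ctranspose ?A ** ?A"
    unfolding mat_abs_def by (rule mat_sqrt_psd[OF psd_ctranspose_mult])+
  then have "ctranspose ?B ** ?B = ctranspose ?A ** ?A"
    by (simp add: positive_semidefinite_def hermitian_def)
  then have "complex_of_real ((norm ?B)\<^sup>2) = of_real ((norm ?A)\<^sup>2)"
    by (metis trace_ctranspose_mult)
  then have "norm ?B = norm ?A"
    by (metis norm_ge_zero of_real_eq_iff power2_eq_iff_nonneg)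
  then show ?thesis
    using Re_trace_le_norm[of ?B] by (simp add: trace_distance_def)
qed

subsection \<open>Dynamics in the energy eigenbasis\<close>

definition cscale :: "complex \<Rightarrow> complex ^ 'm ^ 'n \<Rightarrow> complex ^ 'm ^ 'n" where
  "cscale c A = map_matrix (\<lambda>a. c * a) A"

lemma cscale_nth [simp]: "cscale c A $ i $ j = c * A $ i $ j"
  by (simp add: cscale_def)

lemma cscale_0 [simp]: "cscale 0 A = 0"
  by (simp add: vec_eq_iff)

lemma cscale_1 [simp]: "cscale 1 A = A"
  by (simp add: vec_eq_iff)

lemma cscale_cscale [simp]: "cscale c (cscale d A) = cscale (c * d) A"
  by (simp add: vec_eq_iff)

lemma scaleR_cscale: "r *\<^sub>R cscale c A = cscale (r *\<^sub>R c) A"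
  by (simp add: vec_eq_iff)

lemma cscale_of_real: "cscale (of_real r) A = r *\<^sub>R A"
  by (simp add: vec_eq_iff complex_eq_iff)

lemma cscale_sum_right: "cscale c (\<Sum>i\<in>I. f i) = (\<Sum>i\<in>I. cscale c (f i))"
  by (simp add: vec_eq_iff sum_distrib_left)

lemma cscale_mult_left: "cscale c A ** B = cscale c (A ** B)"
  by (simp add: vec_eq_iff matrix_mult_nth sum_distrib_left mult.assoc)

lemma cscale_mult_right: "A ** cscale c B = cscale c (A ** B)"
  by (simp add: vec_eq_iff matrix_mult_nth sum_distrib_left mult_ac)

lemma bounded_linear_cscale: "bounded_linear (\<lambda>c. cscale c A)"
  by (rule linear_conv_bounded_linear[THEN iffD1], rule linearI)
     (simp_all add: vec_eq_iff algebra_simps)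

lemma matrix_mult_sum_left: "(\<Sum>i\<in>I. f i) ** B = (\<Sum>i\<in>I. f i ** B)"
  for f :: "_ \<Rightarrow> 'a::semiring_1 ^ 'm ^ 'n"
  by (induction I rule: infinite_finite_induct) 
     (simp_all add: vec_eq_iff matrix_matrix_mult_def distrib_right sum.distrib)

lemma matrix_mult_sum_right: "B ** (\<Sum>i\<in>I. f i) = (\<Sum>i\<in>I. B ** f i)"
  for f :: "_ \<Rightarrow> 'a::semiring_1 ^ 'm ^ 'n"
  by (induction I rule: infinite_finite_induct) (simp_all add: matrix_add_ldistrib)

lemma matrix_vector_mult_sum_left: "(\<Sum>i\<in>I. f i) *v v = (\<Sum>i\<in>I. f i *v v)"
  for f :: "_ \<Rightarrow> 'a::semiring_1 ^ 'm ^ 'n"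
  by (induction I rule: infinite_finite_induct) (simp_all add: matrix_vector_mult_add_rdistrib)

lemma trace_sum: "trace (\<Sum>i\<in>I. f i) = (\<Sum>i\<in>I. trace (f i))"
  for f :: "_ \<Rightarrow> 'a::semiring_1 ^ 'n ^ 'n"
  by (induction I rule: infinite_finite_induct) (simp_all add: trace_def sum.distrib)

lemma partial_trace_B_sum:
  "partial_trace_B (\<Sum>i\<in>I. f i) = (\<Sum>i\<in>I. partial_trace_B (f i))"
  by (induction I rule: infinite_finite_induct)
     (simp_all add: vec_eq_iff partial_trace_B_def sum.distrib)

lemma partial_trace_B_cscale: "partial_trace_B (cscale c A) = cscale c (partial_trace_B A)"
  by (simp add: vec_eq_iff partial_trace_B_def sum_distrib_left)

locale energy_decomposition =
  fixes H :: "complex ^ 'n ^ 'n" and d :: nat and E :: "nat \<Rightarrow> real"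
    and P :: "nat \<Rightarrow> complex ^ 'n ^ 'n"
  assumes decomposition: "hamiltonian_decomposition H d E P"
begin

lemmas decomposition_facts = decomposition[unfolded hamiltonian_decomposition_def]
lemmas hermitian_H = decomposition_facts[THEN conjunct1]
lemmas E_bij = decomposition_facts[THEN conjunct2, THEN conjunct1]
lemmas projector =
  decomposition_facts[THEN conjunct2, THEN conjunct2, THEN conjunct1, THEN bspec]
lemmas H_eq = decomposition_facts[THEN conjunct2, THEN conjunct2, THEN conjunct2]

lemma E_eq_iff: "n \<in> {1..d} \<Longrightarrow> m \<in> {1..d} \<Longrightarrow> E n = E m \<longleftrightarrow> n = m"
  using E_bij inj_on_eq_iff[of E "{1..d}"] unfolding bij_betw_def by blast

lemmas projector_facts = projector[unfolded orthogonal_projector_onto_def]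
lemmas hermitian_P = projector_facts[THEN conjunct1]
lemmas P_idem = projector_facts[THEN conjunct2, THEN conjunct1]
lemmas range_P = projector_facts[THEN conjunct2, THEN conjunct2]

lemma H_P_vec:
  assumes "n \<in> {1..d}"
  shows "H *v (P n *v v) = complex_of_real (E n) *s (P n *v v)"
proof -
  have "P n *v v \<in> eigenspace H (E n)"
    unfolding range_P[OF assms, symmetric] by (rule rangeI)
  then show ?thesis by (simp add: eigenspace_def)
qed

lemma P_vec_eigenspace:
  assumes "n \<in> {1..d}" "v \<in> eigenspace H (E n)"
  shows "P n *v v = v"
proof -
  obtain w where "v = P n *v w"
    using assms(2) unfolding range_P[OF assms(1), symmetric] by (rule imageE)
  then show ?thesis by (simp add: matrix_vector_mul_assoc P_idem[OF assms(1)])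
qed

lemma P_orthogonal:
  assumes n: "n \<in> {1..d}" and m: "m \<in> {1..d}" and "n \<noteq> m"
  shows "P n ** P m = 0"
proof -
  have "(P n ** P m) *v w = 0" for w
  proof -
    let ?u = "P n *v (P m *v w)"
    have "cinner (P n *v ?u) (H *v (P m *v w)) = cinner (H *v (P n *v ?u)) (P m *v w)"
      by (rule cinner_hermitian[OF hermitian_H])
    then have "complex_of_real (E m) * cinner (P n *v ?u) (P m *v w)
        = complex_of_real (E n) * cinner (P n *v ?u) (P m *v w)"
      by (simp add: H_P_vec[OF n] H_P_vec[OF m] cinner_scale_left cinner_scale_right)
    moreover have "E n \<noteq> E m" using assms by (simp only: E_eq_iff) simp
    ultimately have "cinner (P n *v ?u) (P m *v w) = 0" by simp
    then have "cinner ?u ?u = 0"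
      by (simp add: cinner_hermitian[OF hermitian_P[OF n]])
    then show ?thesis by (simp add: cinner_self matrix_vector_mul_assoc)
  qed
  then show ?thesis by (simp add: matrix_eq)
qed

lemma P_mult: "n \<in> {1..d} \<Longrightarrow> m \<in> {1..d} \<Longrightarrow> P n ** P m = (if n = m then P n else 0)"
  by (simp add: P_idem P_orthogonal)

text \<open>A vector annihilated by all \<open>P n\<close> is annihilated by \<open>H\<close>, so it is an
  eigenvector of energy zero unless it vanishes.\<close>

lemma P_sum: "(\<Sum>n=1..d. P n) = mat 1"
proof -
  have "(\<Sum>n=1..d. P n) *v v = v" for v
  proof -
    define u where "u = v - (\<Sum>n=1..d. P n) *v v"
    have Pu: "P m *v u = 0" if m: "m \<in> {1..d}" for m
    proof -
      have "P m ** (\<Sum>n=1..d. P n) = (\<Sum>n=1..d. if m = n then P m else 0)"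
        unfolding matrix_mult_sum_right by (rule sum.cong[OF refl], rule P_mult[OF m])
      also have "\<dots> = P m" using m by simp
      finally show ?thesis
        by (simp add: u_def matrix_vector_mult_diff_distrib matrix_vector_mul_assoc)
    qed
    have scale: "(r *\<^sub>R A) *v w = r *\<^sub>R (A *v w)" for r w and A :: "complex ^ 'n ^ 'n"
      by (simp add: vec_eq_iff matrix_vector_mult_def scaleR_sum_right)
    have "H *v u = (\<Sum>n=1..d. E n *\<^sub>R (P n *v u))"
      by (subst H_eq) (simp add: matrix_vector_mult_sum_left scale)
    then have u0: "u \<in> eigenspace H 0"
      by (simp add: Pu eigenspace_def)
    have "u = 0"
    proof (rule ccontr)
      assume "u \<noteq> 0"
      then have "0 \<in> energies H" using u0 by (auto simp: energies_def)
      then obtain m where m: "m \<in> {1..d}" "E m = 0"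
        using E_bij unfolding bij_betw_def by (metis imageE)
      then show False using P_vec_eigenspace[of m u] u0 Pu[of m] \<open>u \<noteq> 0\<close> by simp
    qed
    then show ?thesis by (simp add: u_def)
  qed
  then show ?thesis by (simp add: matrix_eq)
qed

definition spectral_fun :: "(nat \<Rightarrow> complex) \<Rightarrow> complex ^ 'n ^ 'n" where
  "spectral_fun f = (\<Sum>n=1..d. cscale (f n) (P n))"

lemma spectral_fun_mult:
  "spectral_fun f ** spectral_fun g = spectral_fun (\<lambda>n. f n * g n)"
proof -
  have "spectral_fun f ** spectral_fun g =
      (\<Sum>n=1..d. \<Sum>m=1..d. if n = m then cscale (f n * g n) (P n) else 0)"
    unfolding spectral_fun_def matrix_mult_sum_left matrix_mult_sum_right
    by (intro sum.cong refl)
       (auto simp: cscale_mult_left cscale_mult_right P_mult mult.commute vec_eq_iff)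
  then show ?thesis by (simp add: spectral_fun_def)
qed

lemma cscale_H: "cscale c H = spectral_fun (\<lambda>n. c * E n)"
proof -
  have "cscale c H = cscale c (spectral_fun (\<lambda>n. E n))"
    by (subst H_eq) (simp add: spectral_fun_def cscale_of_real)
  then show ?thesis by (simp add: spectral_fun_def cscale_sum_right)
qed

lemma mat_pow_H: "mat_pow (cscale c H) k = spectral_fun (\<lambda>n. (c * E n) ^ k)"
proof (induction k)
  case 0
  then show ?case using P_sum by (simp add: mat_pow_def spectral_fun_def)
next
  case (Suc k)
  have "mat_pow (cscale c H) (Suc k) = cscale c H ** mat_pow (cscale c H) k"
    by (simp add: mat_pow_def)
  then show ?case unfolding Suc by (simp only: cscale_H spectral_fun_mult power_Suc)
qed

lemma mat_exp_H: "mat_exp (cscale c H) = spectral_fun (\<lambda>n. exp (c * E n))"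
proof -
  have "(\<lambda>k. \<Sum>n=1..d. cscale ((c * E n) ^ k /\<^sub>R fact k) (P n)) sums spectral_fun (\<lambda>n. exp (c * E n))"
    unfolding spectral_fun_def
    by (intro sums_sum bounded_linear.sums[OF bounded_linear_cscale] exp_converges)
  moreover have "(\<Sum>n=1..d. cscale ((c * E n) ^ k /\<^sub>R fact k) (P n)) = mat_pow (cscale c H) k /\<^sub>R fact k" for k
    by (simp add: mat_pow_H spectral_fun_def scaleR_sum_right scaleR_cscale)
  ultimately show ?thesis
    by (simp add: mat_exp_def sums_iff)
qed

lemma evolved_state_eq:
  "evolved_state H \<rho> t = (\<Sum>n=1..d. \<Sum>m=1..d. cscale (exp (- \<i> * (E n - E m) * t)) (P n ** \<rho> ** P m))"
proof -
  have eq: "exp (\<i> * t * E m) * exp (- \<i> * t * E n) = exp (- \<i> * (E n - E m) * t)" for n m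
    unfolding exp_add[symmetric] by (simp add: algebra_simps)
  have "evolved_state H \<rho> t = mat_exp (cscale (- \<i> * t) H) ** \<rho> ** mat_exp (cscale (\<i> * t) H)"
    by (simp add: evolved_state_def cscale_def mult_ac)
  also have "\<dots> = (\<Sum>n=1..d. \<Sum>m=1..d. cscale (exp (\<i> * t * E m) * exp (- \<i> * t * E n)) (P n ** \<rho> ** P m))"
    unfolding mat_exp_H spectral_fun_def matrix_mult_sum_left unfolding matrix_mult_sum_right
    by (simp add: cscale_mult_left cscale_mult_right)
  finally show ?thesis unfolding eq .
qed

lemma norm_P_sum: "(\<Sum>n=1..d. (norm (P n ** A))\<^sup>2) = (norm A)\<^sup>2"
  for A :: "complex ^ 'm ^ 'n"
proof -
  have "ctranspose (P n ** A) ** (P n ** A) = ctranspose A ** (P n ** A)" if "n \<in> {1..d}" for n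
    using hermitian_P[OF that] P_idem[OF that]
    by (metis ctranspose_mult hermitian_def matrix_mul_assoc)
  then have "complex_of_real (\<Sum>n=1..d. (norm (P n ** A))\<^sup>2)
      = (\<Sum>n=1..d. trace (ctranspose A ** (P n ** A)))"
    unfolding of_real_sum trace_ctranspose_mult[symmetric] by (intro sum.cong refl) (rule arg_cong)
  also have "\<dots> = trace (ctranspose A ** ((\<Sum>n=1..d. P n) ** A))"
    by (simp only: matrix_mult_sum_left matrix_mult_sum_right trace_sum)
  also have "\<dots> = of_real ((norm A)\<^sup>2)"
    by (simp only: P_sum matrix_mul_lid trace_ctranspose_mult)
  finally show ?thesis by (simp only: of_real_eq_iff)
qed

end

lemma cmod_trace_ctranspose_mult_le: "cmod (trace (ctranspose A ** B)) \<le> norm A * norm B"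
  for A B :: "complex ^ 'm ^ 'n"
proof -
  have "cmod (trace (ctranspose A ** B)) \<le> (\<Sum>j\<in>UNIV. \<Sum>i\<in>UNIV. cmod (A $ i $ j) * cmod (B $ i $ j))"
    unfolding trace_def matrix_mult_nth
    by (intro sum_norm_le) (simp add: ctranspose_def norm_mult)
  also have "\<dots> = (\<Sum>i\<in>UNIV. \<Sum>j\<in>UNIV. cmod (A $ i $ j) * cmod (B $ i $ j))"
    by (rule sum.swap)
  also have "\<dots> \<le> (\<Sum>i\<in>UNIV. norm (A $ i) * norm (B $ i))"
  proof (rule sum_mono)
    fix i
    show "(\<Sum>j\<in>UNIV. cmod (A $ i $ j) * cmod (B $ i $ j)) \<le> norm (A $ i) * norm (B $ i)"
      using L2_set_mult_ineq[of "\<lambda>j. cmod (A $ i $ j)" "\<lambda>j. cmod (B $ i $ j)" UNIV]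
      by (simp add: norm_vec_def)
  qed
  also have "\<dots> \<le> norm A * norm B"
    using L2_set_mult_ineq[of "\<lambda>i. norm (A $ i)" "\<lambda>i. norm (B $ i)" UNIV]
    by (simp add: norm_vec_def)
  finally show ?thesis .
qed

lemma sum_UNIV_Times: "(\<Sum>p\<in>UNIV. f p) = (\<Sum>a\<in>UNIV. \<Sum>b\<in>UNIV. f (a, b))"
  for f :: "'a::finite \<times> 'b::finite \<Rightarrow> 'c::comm_monoid_add"
  by (simp add: sum.cartesian_product)

lemma mult_le_of_power2_le:
  fixes w x y :: real
  assumes "w\<^sup>2 \<le> x * y" "0 \<le> x" "0 \<le> y"
  shows "2 * w \<le> x + y"
proof (rule power2_le_imp_le)
  have "0 \<le> (x - y)\<^sup>2" by simp
  then show "(2 * w)\<^sup>2 \<le> (x + y)\<^sup>2"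
    using assms by (simp add: power2_eq_square algebra_simps)
qed (use assms in simp)

text \<open>With \<open>\<sigma>\<^sup>2 = \<rho>\<close> and \<open>Y i = P i \<sigma>\<close>, the matrix entry \<open>(k, l)\<close> of \<open>tr\<^sub>B (P i \<rho> P j)\<close> is the
  Hilbert-Schmidt product of \<open>Y j\<close> with \<open>Z i k l = (|l><k| \<otimes> 1) Y i\<close>; the orthogonality of the
  \<open>P j\<close> makes the Cauchy-Schwarz bounds summable over \<open>j\<close>.\<close>

lemma sum_norm_partial_trace_le:
  fixes H \<rho> :: "complex ^ ('s::finite \<times> 'b::finite) ^ ('s \<times> 'b)"
  assumes dec: "hamiltonian_decomposition H d E P" and \<rho>: "positive_semidefinite \<rho>"
  shows "(\<Sum>i=1..d. \<Sum>j=1..d. (norm (partial_trace_B (P i ** \<rho> ** P j)))\<^sup>2)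
    \<le> real CARD('s) * (\<Sum>n=1..d. (Re (trace (P n ** \<rho>)))\<^sup>2)"
proof -
  interpret energy_decomposition H d E P using dec by unfold_locales
  define \<sigma> where "\<sigma> = mat_sqrt \<rho>"
  have \<sigma>: "ctranspose \<sigma> = \<sigma>" "\<sigma> ** \<sigma> = \<rho>"
    using mat_sqrt_psd[OF \<rho>] by (auto simp: \<sigma>_def positive_semidefinite_def hermitian_def)
  define X where "X i j = partial_trace_B (P i ** \<rho> ** P j)" for i j
  define Y where "Y i = P i ** \<sigma>" for i
  define Z :: "nat \<Rightarrow> 's \<Rightarrow> 's \<Rightarrow> complex ^ ('s \<times> 'b) ^ ('s \<times> 'b)" where
    "Z i k l = (\<chi> p m. if fst p = l then Y i $ (k, snd p) $ m else 0)" for i k l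
  define p where "p i = Re (trace (P i ** \<rho>))" for i
  define u where "u i j = (\<Sum>k\<in>UNIV. \<Sum>l\<in>UNIV. (norm (P j ** Z i k l))\<^sup>2)" for i j
  have ct_P: "ctranspose (P i) = P i" if "i \<in> {1..d}" for i
    using hermitian_P[OF that] hermitian_def by blast
  have norm_Y: "(norm (Y i))\<^sup>2 = p i" if i: "i \<in> {1..d}" for i
  proof -
    have "ctranspose (Y i) ** Y i = \<sigma> ** (P i ** \<sigma>)"
      unfolding Y_def ctranspose_mult ct_P[OF i] \<sigma>(1)
      by (metis P_idem[OF i] matrix_mul_assoc)
    then have "complex_of_real ((norm (Y i))\<^sup>2) = trace (\<sigma> ** (P i ** \<sigma>))"
      unfolding trace_ctranspose_mult[symmetric] by simp
    also have "\<dots> = trace (P i ** \<rho>)"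
      by (subst trace_mul_sym) (simp add: \<sigma>(2) flip: matrix_mul_assoc)
    finally show ?thesis unfolding p_def by (metis Re_complex_of_real)
  qed
  have X_nth: "X i j $ k $ l = trace (ctranspose (Y j) ** (P j ** Z i k l))"
    if i: "i \<in> {1..d}" and j: "j \<in> {1..d}" for i j k l
  proof -
    have "P i ** \<rho> ** P j = Y i ** ctranspose (Y j)"
      by (simp add: Y_def ctranspose_mult ct_P[OF j] \<sigma>(1) matrix_mul_assoc flip: \<sigma>(2))
    then have "X i j $ k $ l = (\<Sum>b\<in>UNIV. \<Sum>m\<in>UNIV. Y i $ (k, b) $ m * cnj (Y j $ (l, b) $ m))"
      by (simp add: X_def partial_trace_B_def matrix_mult_nth ctranspose_def)
    also have "\<dots> = (\<Sum>q\<in>UNIV. \<Sum>m\<in>UNIV. cnj (Y j $ q $ m) * Z i k l $ q $ m)"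
    proof -
      have "(\<Sum>q\<in>UNIV. \<Sum>m\<in>UNIV. cnj (Y j $ q $ m) * Z i k l $ q $ m) =
          (\<Sum>a\<in>UNIV. if a = l then \<Sum>b\<in>UNIV. \<Sum>m\<in>UNIV. cnj (Y j $ (a, b) $ m) * Y i $ (k, b) $ m else 0)"
        unfolding sum_UNIV_Times by (rule sum.cong) (auto simp: Z_def)
      then show ?thesis by (simp add: mult.commute)
    qed
    also have "\<dots> = (\<Sum>m\<in>UNIV. \<Sum>q\<in>UNIV. cnj (Y j $ q $ m) * Z i k l $ q $ m)"
      by (rule sum.swap)
    also have "\<dots> = trace (ctranspose (Y j) ** Z i k l)"
      by (simp add: trace_def matrix_mult_nth ctranspose_def)
    also have "ctranspose (Y j) = ctranspose (Y j) ** P j"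
      unfolding Y_def ctranspose_mult ct_P[OF j]
      by (simp add: P_idem[OF j] flip: matrix_mul_assoc)
    finally show ?thesis by (simp add: matrix_mul_assoc)
  qed
  have X_le: "(norm (X i j))\<^sup>2 \<le> p j * u i j" if i: "i \<in> {1..d}" and j: "j \<in> {1..d}" for i j
  proof -
    have "(cmod (X i j $ k $ l))\<^sup>2 \<le> p j * (norm (P j ** Z i k l))\<^sup>2" for k l
    proof -
      have "(cmod (X i j $ k $ l))\<^sup>2 \<le> (norm (Y j) * norm (P j ** Z i k l))\<^sup>2"
        unfolding X_nth[OF i j] by (intro power_mono cmod_trace_ctranspose_mult_le) simp
      then show ?thesis by (simp add: power_mult_distrib norm_Y[OF j])
    qed
    then show ?thesis
      unfolding matrix_norm_square u_def sum_distrib_left by (intro sum_mono)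
  qed
  have X_sym: "norm (X i j) = norm (X j i)" if i: "i \<in> {1..d}" and j: "j \<in> {1..d}" for i j
  proof -
    have "P i ** \<rho> ** P j = ctranspose (P j ** \<rho> ** P i)"
      by (simp add: ctranspose_mult ct_P[OF i] ct_P[OF j] \<sigma>(1) matrix_mul_assoc flip: \<sigma>(2))
    then have "X i j $ k $ l = cnj (X j i $ l $ k)" for k l
      by (simp add: X_def partial_trace_B_def ctranspose_def)
    then have "(norm (X i j))\<^sup>2 = (norm (X j i))\<^sup>2"
      unfolding matrix_norm_square by (subst sum.swap) simp
    then show ?thesis by simp
  qed
  have p0: "0 \<le> p i" if "i \<in> {1..d}" for i
    unfolding norm_Y[OF that, symmetric] by simp
  have u0: "0 \<le> u i j" for i j
    by (simp add: u_def sum_nonneg)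
  have X_le': "2 * (norm (X i j))\<^sup>2 \<le> p i * u i j + p j * u j i"
    if i: "i \<in> {1..d}" and j: "j \<in> {1..d}" for i j
  proof (rule mult_le_of_power2_le)
    have "(norm (X i j))\<^sup>2 * (norm (X j i))\<^sup>2 \<le> (p j * u i j) * (p i * u j i)"
      by (intro mult_mono X_le i j mult_nonneg_nonneg p0 u0) simp
    then show "((norm (X i j))\<^sup>2)\<^sup>2 \<le> p i * u i j * (p j * u j i)"
      by (simp add: X_sym[OF i j] power2_eq_square mult_ac)
  qed (rule mult_nonneg_nonneg p0 u0 i j)+
  have u_sum: "(\<Sum>j=1..d. u i j) = real CARD('s) * p i" if i: "i \<in> {1..d}" for i
  proof -
    have norm_Z: "(norm (Z i k l))\<^sup>2 = (\<Sum>b\<in>UNIV. \<Sum>m\<in>UNIV. (cmod (Y i $ (k, b) $ m))\<^sup>2)" for k l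
    proof -
      have "(norm (Z i k l))\<^sup>2 =
          (\<Sum>a\<in>UNIV. if a = l then \<Sum>b\<in>UNIV. \<Sum>m\<in>UNIV. (cmod (Y i $ (k, b) $ m))\<^sup>2 else 0)"
        unfolding matrix_norm_square sum_UNIV_Times by (rule sum.cong) (auto simp: Z_def)
      then show ?thesis by simp
    qed
    have "(\<Sum>j=1..d. u i j) = (\<Sum>k\<in>UNIV. \<Sum>l\<in>UNIV. \<Sum>j=1..d. (norm (P j ** Z i k l))\<^sup>2)"
      unfolding u_def by (simp only: sum.swap[of _ UNIV "{1..d}"])
    also have "\<dots> = (\<Sum>l\<in>(UNIV::'s set). \<Sum>k\<in>UNIV. \<Sum>b\<in>UNIV. \<Sum>m\<in>UNIV. (cmod (Y i $ (k, b) $ m))\<^sup>2)"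
      unfolding norm_P_sum norm_Z by (rule sum.swap)
    also have "\<dots> = real CARD('s) * (norm (Y i))\<^sup>2"
      by (simp add: matrix_norm_square sum_UNIV_Times)
    finally show ?thesis by (simp add: norm_Y[OF i])
  qed
  have "2 * (\<Sum>i=1..d. \<Sum>j=1..d. (norm (X i j))\<^sup>2)
      \<le> (\<Sum>i=1..d. \<Sum>j=1..d. p i * u i j + p j * u j i)"
    unfolding sum_distrib_left by (intro sum_mono X_le')
  also have "\<dots> = (\<Sum>i=1..d. \<Sum>j=1..d. p i * u i j) + (\<Sum>i=1..d. \<Sum>j=1..d. p j * u j i)"
    by (simp add: sum.distrib)
  also have "(\<Sum>i=1..d. \<Sum>j=1..d. p j * u j i) = (\<Sum>i=1..d. \<Sum>j=1..d. p i * u i j)"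
    by (rule sum.swap)
  also have "(\<Sum>i=1..d. \<Sum>j=1..d. p i * u i j) = real CARD('s) * (\<Sum>i=1..d. (p i)\<^sup>2)"
    unfolding sum_distrib_left
  proof (rule sum.cong[OF refl])
    fix i assume "i \<in> {1..d}"
    then show "(\<Sum>j=1..d. p i * u i j) = real CARD('s) * (p i)\<^sup>2"
      unfolding sum_distrib_left[symmetric] by (simp only: u_sum power2_eq_square mult_ac)
  qed
  finally show ?thesis by (simp add: X_def p_def)
qed

subsection \<open>Mean squares of trigonometric sums\<close>

lemma std_normal_iexp_integral:
  "has_bochner_integral lborel (\<lambda>s. std_normal_density s *\<^sub>R iexp (w * s))
     (complex_of_real (exp (- w\<^sup>2 / 2)))"
proof -
  interpret real_distribution std_normal_distribution
    by (rule real_dist_normal_dist)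
  have "integrable std_normal_distribution (\<lambda>s. iexp (w * s))"
    by (rule integrable_iexp) simp_all
  then have "integrable lborel (\<lambda>s. std_normal_density s *\<^sub>R iexp (w * s))"
    by (subst (asm) integrable_density) simp_all
  moreover have "(LINT s|lborel. std_normal_density s *\<^sub>R iexp (w * s)) = char std_normal_distribution w"
    unfolding char_def by (subst integral_density) simp_all
  ultimately show ?thesis
    by (simp add: has_bochner_integral_iff char_std_normal_distribution)
qed

text \<open>A multiple of the Gaussian density majorises the indicator of \<open>{-r..r}\<close> and has a
  positive Fourier transform.\<close>

lemma trig_sum_square_integral_le:
  fixes c :: "'a \<Rightarrow> complex" and w :: "'a \<Rightarrow> real"
  assumes fin: "finite A" and r: "0 \<le> r"
  shows "integral {-r..r} (\<lambda>s. (cmod (\<Sum>a\<in>A. c a * iexp (w a * s)))\<^sup>2)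
    \<le> exp (r\<^sup>2 / 2) * sqrt (2 * pi) *
        (\<Sum>a\<in>A. \<Sum>b\<in>A. cmod (c a) * cmod (c b) * exp (- (w a - w b)\<^sup>2 / 2))"
proof -
  define F where "F s = (\<Sum>a\<in>A. c a * iexp (w a * s))" for s
  define J where "J = (\<Sum>a\<in>A. \<Sum>b\<in>A. (c a * cnj (c b)) * complex_of_real (exp (- (w a - w b)\<^sup>2 / 2)))"
  have phase: "iexp (w a * s) * cnj (iexp (w b * s)) = iexp ((w a - w b) * s)" for a b s
    unfolding exp_cnj exp_add[symmetric] by (simp add: algebra_simps)
  have Fsq: "complex_of_real ((cmod (F s))\<^sup>2) = (\<Sum>a\<in>A. \<Sum>b\<in>A. (c a * cnj (c b)) * iexp ((w a - w b) * s))" for s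
    unfolding complex_norm_square F_def cnj_sum sum_product complex_cnj_mult
    by (intro sum.cong refl) (subst phase[symmetric], simp only: mult_ac)
  have "has_bochner_integral lborel
      (\<lambda>s. \<Sum>a\<in>A. \<Sum>b\<in>A. (c a * cnj (c b)) * (std_normal_density s *\<^sub>R iexp ((w a - w b) * s))) J"
    unfolding J_def
    by (intro has_bochner_integral_sum has_bochner_integral_mult_right std_normal_iexp_integral)
  moreover have "(\<Sum>a\<in>A. \<Sum>b\<in>A. (c a * cnj (c b)) * (std_normal_density s *\<^sub>R iexp ((w a - w b) * s)))
      = complex_of_real (std_normal_density s * (cmod (F s))\<^sup>2)" for s
    unfolding of_real_mult Fsq sum_distrib_left
    by (intro sum.cong refl) (simp add: scaleR_conv_of_real mult_ac)
  ultimately have "has_bochner_integral lborel (\<lambda>s. complex_of_real (std_normal_density s * (cmod (F s))\<^sup>2)) J"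
    by simp
  from has_bochner_integral_Re[OF this]
  have int: "has_bochner_integral lborel (\<lambda>s. std_normal_density s * (cmod (F s))\<^sup>2) (Re J)"
    by simp
  have HK: "((\<lambda>s. std_normal_density s * (cmod (F s))\<^sup>2) has_integral Re J) UNIV"
    using has_integral_integral_lborel[of "\<lambda>s. std_normal_density s * (cmod (F s))\<^sup>2"] int
    by (simp add: has_bochner_integral_iff)
  have cF: "continuous_on S (\<lambda>s. (cmod (F s))\<^sup>2)" for S
    unfolding F_def by (intro continuous_intros)
  have cd: "continuous_on S (\<lambda>s. std_normal_density s * (cmod (F s))\<^sup>2)" for S
    unfolding std_normal_density_def by (intro continuous_intros cF) auto
  have "integral {-r..r} (\<lambda>s. (cmod (F s))\<^sup>2)
      \<le> integral {-r..r} (\<lambda>s. exp (r\<^sup>2 / 2) * sqrt (2 * pi) * (std_normal_density s * (cmod (F s))\<^sup>2))"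
  proof (rule integral_le)
    fix s assume s: "s \<in> {-r..r}"
    then have "s\<^sup>2 \<le> r\<^sup>2" using r by (simp add: abs_le_square_iff[symmetric] abs_le_iff)
    then have "exp 0 \<le> exp (r\<^sup>2 / 2 + (- s\<^sup>2 / 2))"
      by (subst exp_le_cancel_iff) simp
    then have "1 \<le> exp (r\<^sup>2 / 2) * sqrt (2 * pi) * std_normal_density s"
      by (simp add: std_normal_density_def exp_add[symmetric] del: exp_le_cancel_iff)
    then have "1 * (cmod (F s))\<^sup>2 \<le> exp (r\<^sup>2 / 2) * sqrt (2 * pi) * std_normal_density s * (cmod (F s))\<^sup>2"
      by (rule mult_right_mono) simp
    then show "(cmod (F s))\<^sup>2 \<le> exp (r\<^sup>2 / 2) * sqrt (2 * pi) * (std_normal_density s * (cmod (F s))\<^sup>2)"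
      by (simp add: mult.assoc)
  qed (intro integrable_continuous_interval continuous_on_mult_left cF cd)+
  also have "\<dots> = exp (r\<^sup>2 / 2) * sqrt (2 * pi) * integral {-r..r} (\<lambda>s. std_normal_density s * (cmod (F s))\<^sup>2)"
    by (rule integral_mult_right)
  also have "\<dots> \<le> exp (r\<^sup>2 / 2) * sqrt (2 * pi) * integral UNIV (\<lambda>s. std_normal_density s * (cmod (F s))\<^sup>2)"
    by (intro mult_left_mono integral_subset_le integrable_continuous_interval cd
        has_integral_integrable[OF HK]) auto
  also have "\<dots> \<le> exp (r\<^sup>2 / 2) * sqrt (2 * pi) *
        (\<Sum>a\<in>A. \<Sum>b\<in>A. cmod (c a) * cmod (c b) * exp (- (w a - w b)\<^sup>2 / 2))"
  proof (intro mult_left_mono)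
    have "Re J \<le> cmod J" by (rule complex_Re_le_cmod)
    also have "\<dots> \<le> (\<Sum>a\<in>A. \<Sum>b\<in>A. cmod (c a) * cmod (c b) * exp (- (w a - w b)\<^sup>2 / 2))"
      unfolding J_def by (intro sum_norm_le) (simp add: norm_mult)
    finally show "integral UNIV (\<lambda>s. std_normal_density s * (cmod (F s))\<^sup>2) \<le> \<dots>"
      by (simp add: integral_unique[OF HK])
  qed auto
  finally show ?thesis by (simp add: F_def)
qed

lemma sum_symmetric_le:
  fixes K :: "'a \<Rightarrow> 'a \<Rightarrow> real" and x :: "'a \<Rightarrow> real"
  assumes sym: "\<And>a b. K a b = K b a" and K: "\<And>a b. 0 \<le> K a b"
    and row: "\<And>a. a \<in> A \<Longrightarrow> (\<Sum>b\<in>A. K a b) \<le> R"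
  shows "(\<Sum>a\<in>A. \<Sum>b\<in>A. x a * x b * K a b) \<le> R * (\<Sum>a\<in>A. (x a)\<^sup>2)"
proof -
  have "2 * (x a * x b * K a b) \<le> (x a)\<^sup>2 * K a b + (x b)\<^sup>2 * K a b" for a b
  proof -
    have "0 \<le> (x a - x b)\<^sup>2 * K a b" using K by simp
    then show ?thesis by (simp add: power2_eq_square algebra_simps)
  qed
  then have "2 * (\<Sum>a\<in>A. \<Sum>b\<in>A. x a * x b * K a b)
      \<le> (\<Sum>a\<in>A. \<Sum>b\<in>A. (x a)\<^sup>2 * K a b + (x b)\<^sup>2 * K a b)"
    unfolding sum_distrib_left by (intro sum_mono)
  also have "\<dots> = (\<Sum>a\<in>A. \<Sum>b\<in>A. (x a)\<^sup>2 * K a b) + (\<Sum>a\<in>A. \<Sum>b\<in>A. (x b)\<^sup>2 * K a b)"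
    by (simp add: sum.distrib)
  also have "(\<Sum>a\<in>A. \<Sum>b\<in>A. (x b)\<^sup>2 * K a b) = (\<Sum>b\<in>A. \<Sum>a\<in>A. (x b)\<^sup>2 * K b a)"
    by (subst sum.swap) (simp add: sym[of _ b for b])
  finally have "(\<Sum>a\<in>A. \<Sum>b\<in>A. x a * x b * K a b) \<le> (\<Sum>a\<in>A. (x a)\<^sup>2 * (\<Sum>b\<in>A. K a b))"
    by (simp add: sum_distrib_left[symmetric])
  also have "\<dots> \<le> (\<Sum>a\<in>A. (x a)\<^sup>2 * R)"
    by (intro sum_mono mult_left_mono row) auto
  finally show ?thesis by (simp add: sum_distrib_left mult.commute)
qed

lemma gaussian_sum_le:
  assumes "b > 0"
  shows "(\<Sum>k=1..n. exp (- (real k * b)\<^sup>2)) \<le> sqrt pi / 2 / b"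
proof -
  define f where "f s = exp (- s\<^sup>2)" for s :: real
  have f_cont: "continuous_on S f" for S
    unfolding f_def by (intro continuous_intros)
  have step: "b * f (real (Suc k) * b) \<le> integral {real k * b..real (Suc k) * b} f" for k
  proof -
    have "b * f (real (Suc k) * b) = integral {real k * b..real (Suc k) * b} (\<lambda>_. f (real (Suc k) * b))"
      using assms by (simp add: algebra_simps)
    also have "\<dots> \<le> integral {real k * b..real (Suc k) * b} f"
    proof (rule integral_le)
      fix s assume s: "s \<in> {real k * b..real (Suc k) * b}"
      have "0 \<le> real k * b" using assms by simp
      then have "0 \<le> s" using s by simp
      then have "s\<^sup>2 \<le> (real (Suc k) * b)\<^sup>2" using s by (intro power_mono) auto
      then show "f (real (Suc k) * b) \<le> f s" by (simp add: f_def)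
    qed (intro integrable_continuous_interval f_cont continuous_on_const)+
    finally show ?thesis .
  qed
  have partial: "b * (\<Sum>k=1..n. f (real k * b)) \<le> integral {0..real n * b} f"
  proof (induction n)
    case (Suc n)
    have "integral {0..real n * b} f + integral {real n * b..real (Suc n) * b} f = integral {0..real (Suc n) * b} f"
      using assms by (intro Henstock_Kurzweil_Integration.integral_combine integrable_continuous_interval f_cont) auto
    then show ?case using Suc step[of n] by (simp add: algebra_simps)
  qed simp

  have f_integral: "(f has_integral (sqrt pi / 2)) {0..}"
    using set_borel_integral_eq_integral[of "{0..}" f] gaussian_moment_0
    by (simp add: has_bochner_integral_iff set_integrable_def set_lebesgue_integral_def f_def[abs_def]
        has_integral_iff)
  have "b * (\<Sum>k=1..n. f (real k * b)) \<le> integral {0..} f"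
    by (rule order_trans[OF partial integral_subset_le])
       (auto intro!: integrable_continuous_interval f_cont has_integral_integrable[OF f_integral]
         simp: f_def)
  then show ?thesis
    using assms by (simp add: integral_unique[OF f_integral] f_def field_simps)
qed

lemma gap_row_sum_le:
  fixes w :: "'a \<Rightarrow> real" and N :: nat
  assumes fin: "finite A" and pos: "\<epsilon> > 0" "\<tau> > 0"
    and count: "\<And>e. card {b \<in> A. w b \<in> {e..<e + \<epsilon>}} \<le> N"
  shows "(\<Sum>b\<in>A. exp (- ((x - w b) * \<tau>)\<^sup>2)) \<le> 2 * N * (1 + sqrt pi / 2 / (\<epsilon> * \<tau>))"
proof -
  define k where "k b = \<lfloor>(w b - x) / \<epsilon>\<rfloor>" for b
  define m where "m b = nat (if k b \<ge> 0 then k b else - k b - 1)" for b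
  define g where "g j = exp (- (real j * (\<epsilon> * \<tau>))\<^sup>2)" for j
  have k: "k b * \<epsilon> \<le> w b - x" "w b - x < (real_of_int (k b) + 1) * \<epsilon>" for b
  proof -
    have "k b \<le> (w b - x) / \<epsilon>" "(w b - x) / \<epsilon> < k b + 1"
      unfolding k_def by linarith+
    then show "k b * \<epsilon> \<le> w b - x" "w b - x < (real_of_int (k b) + 1) * \<epsilon>"
      using pos by (simp_all add: pos_le_divide_eq pos_divide_less_eq)
  qed
  have term_le: "exp (- ((x - w b) * \<tau>)\<^sup>2) \<le> g (m b)" for b
  proof -
    have "real (m b) * \<epsilon> \<le> \<bar>x - w b\<bar>"
    proof (cases "k b \<ge> 0")
      case True
      then show ?thesis using k(1)[of b] by (simp add: m_def)
    next
      case False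
      then have m: "real (m b) = - (real_of_int (k b) + 1)" by (simp add: m_def)
      have "real (m b) * \<epsilon> = - ((real_of_int (k b) + 1) * \<epsilon>)"
        unfolding m by (simp add: algebra_simps)
      then show ?thesis using k(2)[of b] by linarith
    qed
    then have "real (m b) * \<epsilon> * \<tau> \<le> \<bar>x - w b\<bar> * \<tau>"
      using pos by (intro mult_right_mono) auto
    then have "(real (m b) * \<epsilon> * \<tau>)\<^sup>2 \<le> (\<bar>x - w b\<bar> * \<tau>)\<^sup>2"
      using pos by (intro power_mono) auto
    then show ?thesis by (simp add: g_def power_mult_distrib mult.assoc)
  qed
  have card_le: "card {b \<in> A. m b = j} \<le> 2 * N" for j
  proof -
    let ?U = "{b \<in> A. w b \<in> {x + j * \<epsilon>..<x + j * \<epsilon> + \<epsilon>}}"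
    let ?L = "{b \<in> A. w b \<in> {x - (real j + 1) * \<epsilon>..<x - (real j + 1) * \<epsilon> + \<epsilon>}}"
    have "b \<in> ?U \<union> ?L" if b: "b \<in> A" "m b = j" for b
    proof (cases "k b \<ge> 0")
      case True
      then have "real_of_int (k b) = j" using b by (auto simp: m_def)
      then show ?thesis using k[of b] b by (simp add: algebra_simps)
    next
      case False
      then have kb: "real_of_int (k b) = - real j - 1" using b by (auto simp: m_def)
      show ?thesis using k[of b, unfolded kb] b by (simp add: algebra_simps)
    qed
    then have "card {b \<in> A. m b = j} \<le> card (?U \<union> ?L)"
      using fin by (intro card_mono) auto
    also have "\<dots> \<le> card ?U + card ?L" by (rule card_Un_le)
    also have "\<dots> \<le> 2 * N" using count[of "x + j * \<epsilon>"] count[of "x - (real j + 1) * \<epsilon>"] by linarith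
    finally show ?thesis .
  qed
  obtain M where M: "\<And>b. b \<in> A \<Longrightarrow> m b \<le> M"
    using finite_nat_set_iff_bounded_le[of "m ` A"] fin by auto
  have "(\<Sum>b\<in>A. exp (- ((x - w b) * \<tau>)\<^sup>2)) \<le> (\<Sum>b\<in>A. g (m b))"
    by (intro sum_mono term_le)
  also have "\<dots> = (\<Sum>j\<in>{..M}. \<Sum>b\<in>{b \<in> A. m b = j}. g (m b))"
    using fin M by (intro sum.group[symmetric]) auto
  also have "\<dots> = (\<Sum>j\<in>{..M}. real (card {b \<in> A. m b = j}) * g j)"
    by (intro sum.cong refl) simp
  also have "\<dots> \<le> (\<Sum>j\<in>{..M}. real (2 * N) * g j)"
    by (intro sum_mono mult_right_mono of_nat_mono card_le) (simp add: g_def)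
  also have "\<dots> = 2 * N * (\<Sum>j\<in>{..M}. g j)"
    by (simp add: sum_distrib_left)
  also have "(\<Sum>j\<in>{..M}. g j) = 1 + (\<Sum>j=1..M. g j)"
    unfolding atMost_atLeast0 by (subst sum.atLeast_Suc_atMost) (simp_all add: g_def)
  also have "(\<Sum>j=1..M. g j) \<le> sqrt pi / 2 / (\<epsilon> * \<tau>)"
    unfolding g_def using pos by (intro gaussian_sum_le) simp
  finally show ?thesis by (simp add: mult_left_mono)
qed

text \<open>The Gaussian majorant is centred at \<open>T / 2\<close>, with value \<open>1\<close> at both ends of \<open>{0..T}\<close> and
  \<open>exp (1 / 5) \<le> 5 / 4\<close> at the centre; this is where the factor \<open>5\<close> of the bound comes from.\<close>

lemma trig_sum_time_average_le:
  fixes c :: "'a \<Rightarrow> complex" and w :: "'a \<Rightarrow> real" and N :: nat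
  assumes fin: "finite A" and pos: "\<epsilon> > 0" "T > 0"
    and count: "\<And>e. card {b \<in> A. w b \<in> {e..<e + \<epsilon>}} \<le> N"
  shows "integral {0..T} (\<lambda>t::real. (cmod (\<Sum>a\<in>A. c a * exp (- \<i> * w a * t)))\<^sup>2) / T
    \<le> 5 * pi * N / 2 * (3 / 4 + 1 / (\<epsilon> * T)) * (\<Sum>a\<in>A. (cmod (c a))\<^sup>2)"
proof -
  define F where "F t = (cmod (\<Sum>a\<in>A. c a * exp (- \<i> * w a * t)))\<^sup>2" for t :: real
  define r \<sigma> \<tau> where "r = sqrt (2 / 5)" and "\<sigma> = T / (2 * r)" and "\<tau> = T * sqrt 5 / 4"
  define c' where "c' a = c a * exp (- \<i> * w a * (T / 2))" for a
  define w' where "w' a = - \<sigma> * w a" for a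
  define S where "S = (\<Sum>a\<in>A. (cmod (c a))\<^sup>2)"
  have r: "r > 0" "r\<^sup>2 = 2 / 5" by (simp_all add: r_def)
  have \<sigma>: "\<sigma> > 0" "\<sigma> * r = T / 2" using r pos by (simp_all add: \<sigma>_def)
  have \<tau>: "\<tau> > 0" "\<tau>\<^sup>2 = \<sigma>\<^sup>2 / 2"
    using pos by (simp_all add: \<tau>_def \<sigma>_def power_mult_distrib power_divide r(2))
  have S: "S \<ge> 0" by (simp add: S_def sum_nonneg)
  have F_cont: "continuous_on X F" for X
    unfolding F_def by (intro continuous_intros)
  have F_eq: "F (T / 2 + \<sigma> * s) = (cmod (\<Sum>a\<in>A. c' a * iexp (w' a * s)))\<^sup>2" for s
  proof -
    have "exp (- \<i> * w a * (T / 2 + \<sigma> * s)) = exp (- \<i> * w a * (T / 2)) * iexp (w' a * s)" for a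
      unfolding w'_def exp_add[symmetric] by (simp add: algebra_simps)
    then show ?thesis by (simp add: F_def c'_def mult.assoc)
  qed
  have range: "T / 2 + \<sigma> * s \<in> {0..T}" if "s \<in> {-r..r}" for s
    using mult_left_mono[of s r \<sigma>] mult_left_mono[of "- r" s \<sigma>] that \<sigma> by simp
  have "((\<lambda>s. \<sigma> *\<^sub>R F (T / 2 + \<sigma> * s)) has_integral
      integral {T / 2 + \<sigma> * (- r)..T / 2 + \<sigma> * r} F) {-r..r}"
    using r \<sigma>(1) range
    by (intro has_integral_substitution[where c = 0 and d = T] F_cont)
       (auto intro!: derivative_eq_intros simp del: atLeastAtMost_iff)
  then have "integral {0..T} F = integral {-r..r} (\<lambda>s. \<sigma> * F (T / 2 + \<sigma> * s))"
    using \<sigma> by (simp add: has_integral_iff)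
  also have "\<dots> = \<sigma> * integral {-r..r} (\<lambda>s. (cmod (\<Sum>a\<in>A. c' a * iexp (w' a * s)))\<^sup>2)"
    by (simp add: F_eq)
  also have "\<dots> \<le> \<sigma> * (exp (r\<^sup>2 / 2) * sqrt (2 * pi) *
        (\<Sum>a\<in>A. \<Sum>b\<in>A. cmod (c' a) * cmod (c' b) * exp (- (w' a - w' b)\<^sup>2 / 2)))"
    using r \<sigma> by (intro mult_left_mono trig_sum_square_integral_le fin) auto
  also have "(\<Sum>a\<in>A. \<Sum>b\<in>A. cmod (c' a) * cmod (c' b) * exp (- (w' a - w' b)\<^sup>2 / 2))
      = (\<Sum>a\<in>A. \<Sum>b\<in>A. cmod (c a) * cmod (c b) * exp (- ((w a - w b) * \<tau>)\<^sup>2))"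
  proof -
    have "(w' a - w' b)\<^sup>2 / 2 = ((w a - w b) * \<tau>)\<^sup>2" for a b
    proof -
      have "w' a - w' b = - \<sigma> * (w a - w b)" by (simp add: w'_def algebra_simps)
      then show ?thesis by (simp add: power_mult_distrib \<tau>(2))
    qed
    then show ?thesis by (simp add: c'_def norm_mult)
  qed
  also have "\<dots> \<le> 2 * N * (1 + sqrt pi / 2 / (\<epsilon> * \<tau>)) * S"
    unfolding S_def
    by (intro sum_symmetric_le gap_row_sum_le[OF fin pos(1) \<tau>(1) count])
       (simp_all add: power_mult_distrib power2_commute)
  finally have "integral {0..T} F \<le> \<sigma> * (exp (r\<^sup>2 / 2) * sqrt (2 * pi) * (2 * N * (1 + sqrt pi / 2 / (\<epsilon> * \<tau>)) * S))"
    using \<sigma> by (simp add: mult_left_mono)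
  then have "integral {0..T} F / T \<le> \<sigma> * (exp (r\<^sup>2 / 2) * sqrt (2 * pi) * (2 * N * (1 + sqrt pi / 2 / (\<epsilon> * \<tau>)) * S)) / T"
    using pos by (simp add: divide_right_mono)
  also have "\<dots> = exp (1 / 5) * (N * (sqrt (5 * pi) + 2 * pi / (\<epsilon> * T)) * S)"
  proof -
    define y where "y = sqrt pi / 2 / (\<epsilon> * \<tau>)"
    have prefactor: "\<sigma> * sqrt (2 * pi) / T = sqrt (5 * pi) / 2"
      using pos by (simp add: \<sigma>_def r_def real_sqrt_divide real_sqrt_mult)
    have tail: "sqrt (5 * pi) * y = 2 * pi / (\<epsilon> * T)"
      using pos by (simp add: y_def \<tau>_def real_sqrt_mult field_simps)
    have "\<sigma> * (exp (r\<^sup>2 / 2) * sqrt (2 * pi) * (2 * N * (1 + y) * S)) / T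
        = exp (1 / 5) * (N * (2 * (\<sigma> * sqrt (2 * pi) / T) * (1 + y)) * S)"
      by (simp add: r(2))
    also have "2 * (\<sigma> * sqrt (2 * pi) / T) * (1 + y) = sqrt (5 * pi) + sqrt (5 * pi) * y"
      unfolding prefactor by (simp add: distrib_left)
    finally show ?thesis unfolding tail unfolding y_def .
  qed
  also have "\<dots> \<le> 5 / 4 * (N * (3 * pi / 2 + 2 * pi / (\<epsilon> * T)) * S)"
  proof (intro mult_mono)
    have "1 - 1 / 5 \<le> exp (- (1 / 5) :: real)" using exp_ge_add_one_self[of "- (1 / 5) :: real"] by simp
    then show "exp (1 / 5) \<le> (5 / 4 :: real)" by (simp add: exp_minus field_simps)
    have "20 / 9 * pi \<le> pi * pi" using pi_ge_two pi_approx by (intro mult_right_mono) auto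
    then have "5 * pi \<le> (3 * pi / 2)\<^sup>2" by (simp add: power2_eq_square)
    then show "sqrt (5 * pi) + 2 * pi / (\<epsilon> * T) \<le> 3 * pi / 2 + 2 * pi / (\<epsilon> * T)"
      using real_sqrt_le_mono[of "5 * pi" "(3 * pi / 2)\<^sup>2"] by simp
  qed (use pos S in \<open>auto intro!: add_nonneg_nonneg mult_nonneg_nonneg\<close>)
  also have "\<dots> = 5 * pi * N / 2 * (3 / 4 + 1 / (\<epsilon> * T)) * S"
    by (simp add: algebra_simps)
  finally show ?thesis by (simp add: F_def[abs_def] S_def)
qed

subsection \<open>Time averages\<close>

lemma exp_time_average_tendsto:
  "((\<lambda>T. integral {0..T} (\<lambda>t::real. exp (- \<i> * of_real w * of_real t)) /\<^sub>R T) \<longlongrightarrow> (if w = 0 then 1 else 0)) at_top"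
proof (cases "w = 0")
  case True
  have "eventually (\<lambda>T. 1 = integral {0..T} (\<lambda>t::real. exp (- \<i> * of_real w * of_real t)) /\<^sub>R T) at_top"
    using eventually_gt_at_top[of 0] by eventually_elim (simp add: True scaleR_conv_of_real)
  then show ?thesis using True by (simp add: tendsto_eventually eventually_mono)
next
  case False
  have int: "integral {0..T} (\<lambda>t::real. exp (- \<i> * of_real w * of_real t)) = (exp (- \<i> * of_real w * of_real T) - 1) / (- \<i> * of_real w)"
    if "T > 0" for T
  proof -
    have "((\<lambda>t. exp (- \<i> * of_real w * of_real t)) has_integral
        (exp (- \<i> * of_real w * of_real T) / (- \<i> * of_real w) - exp (- \<i> * of_real w * of_real 0) / (- \<i> * of_real w))) {0..T}"
      using that False
      by (intro fundamental_theorem_of_calculus)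
         (auto intro!: derivative_eq_intros has_vector_derivative_real_field)
    then show ?thesis by (simp add: integral_unique diff_divide_distrib)
  qed
  have "((\<lambda>T. 2 / \<bar>w\<bar> * inverse T) \<longlongrightarrow> 0) at_top"
    using tendsto_mult_right_zero[OF tendsto_inverse_0_at_top[OF filterlim_ident]] by blast
  moreover have "eventually (\<lambda>T. cmod (integral {0..T} (\<lambda>t::real. exp (- \<i> * of_real w * of_real t)) /\<^sub>R T)
      \<le> 2 / \<bar>w\<bar> * inverse T) at_top"
    using eventually_gt_at_top[of 0]
  proof eventually_elim
    case (elim T)
    have "cmod (exp (- \<i> * of_real w * of_real T) - 1) \<le> cmod (exp (\<i> * of_real (- w * T))) + cmod 1"
      by (rule order_trans[OF _ norm_triangle_ineq4]) (simp add: mult.assoc)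
    also have "\<dots> = 2" unfolding norm_exp_i_times by simp
    finally have "cmod (exp (- \<i> * of_real w * of_real T) - 1) * (inverse T / \<bar>w\<bar>) \<le> 2 * (inverse T / \<bar>w\<bar>)"
      using elim by (intro mult_right_mono) auto
    then show ?case unfolding int[OF elim]
      using elim by (simp add: norm_divide norm_inverse norm_mult mult_ac divide_inverse)
  qed
  ultimately have "((\<lambda>T. integral {0..T} (\<lambda>t::real. exp (- \<i> * of_real w * of_real t)) /\<^sub>R T) \<longlongrightarrow> 0) at_top"
    by (rule Lim_null_comparison[rotated])
  then show ?thesis using False by simp
qed

lemma infinite_time_average_trig_sum:
  fixes w :: "'a \<Rightarrow> real" and X :: "'a \<Rightarrow> complex ^ 'm ^ 'n"
  assumes fin: "finite I"
  shows "infinite_time_average (\<lambda>t. \<Sum>p\<in>I. cscale (exp (- \<i> * w p * t)) (X p)) = (\<Sum>p | p \<in> I \<and> w p = 0. X p)"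
proof -
  define e where "e p t = exp (- \<i> * of_real (w p) * of_real t)" for p and t :: real
  have e_int: "e p integrable_on {0..T}" for p T
    unfolding e_def by (intro integrable_continuous_interval continuous_intros)
  have avg: "time_average (\<lambda>t. \<Sum>p\<in>I. cscale (e p t) (X p)) T
      = (\<Sum>p\<in>I. cscale (integral {0..T} (e p) /\<^sub>R T) (X p))" for T
  proof -
    have "((\<lambda>t. cscale (e p t) (X p)) has_integral cscale (integral {0..T} (e p)) (X p)) {0..T}" for p
      using has_integral_linear[OF integrable_integral[OF e_int] bounded_linear_cscale]
      by (simp only: o_def)
    then have "integral {0..T} (\<lambda>t. \<Sum>p\<in>I. cscale (e p t) (X p)) = (\<Sum>p\<in>I. cscale (integral {0..T} (e p)) (X p))"
      by (intro integral_unique has_integral_sum fin)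
    then show ?thesis by (simp add: time_average_def scaleR_sum_right scaleR_cscale)
  qed
  have "((\<lambda>T. \<Sum>p\<in>I. cscale (integral {0..T} (e p) /\<^sub>R T) (X p)) \<longlongrightarrow>
      (\<Sum>p\<in>I. cscale (if w p = 0 then 1 else 0) (X p))) at_top"
    unfolding e_def
    by (intro tendsto_sum bounded_linear.tendsto[OF bounded_linear_cscale] exp_time_average_tendsto)
  moreover have "(\<Sum>p\<in>I. cscale (if w p = 0 then 1 else 0) (X p)) = (\<Sum>p\<in>I. if w p = 0 then X p else 0)"
    by (rule sum.cong) auto
  moreover have "\<dots> = (\<Sum>p | p \<in> I \<and> w p = 0. X p)"
    by (rule sum.inter_filter[OF fin, symmetric])
  ultimately have "(time_average (\<lambda>t. \<Sum>p\<in>I. cscale (e p t) (X p)) \<longlongrightarrow> (\<Sum>p | p \<in> I \<and> w p = 0. X p)) at_top"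
    by (simp add: avg[abs_def])
  then show ?thesis
    unfolding infinite_time_average_def e_def by (intro tendsto_Lim trivial_limit_at_top_linorder)
qed

lemma subsystem_state_deviation:
  assumes "hamiltonian_decomposition H d E P"
  shows "subsystem_state H \<rho> t - infinite_time_average (subsystem_state H \<rho>)
    = (\<Sum>\<alpha>\<in>gap_indices d. cscale (exp (- \<i> * energy_gap E \<alpha> * t))
        (partial_trace_B (P (fst \<alpha>) ** \<rho> ** P (snd \<alpha>))))"
proof -
  interpret energy_decomposition H d E P using assms by unfold_locales
  let ?I = "{1..d} \<times> {1..d}"
  define X where "X \<alpha> = partial_trace_B (P (fst \<alpha>) ** \<rho> ** P (snd \<alpha>))" for \<alpha>
  let ?f = "\<lambda>\<alpha> t. cscale (exp (- \<i> * energy_gap E \<alpha> * t)) (X \<alpha>)"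
  have state: "subsystem_state H \<rho> t = (\<Sum>\<alpha>\<in>?I. ?f \<alpha> t)" for t
    by (simp add: subsystem_state_def evolved_state_eq partial_trace_B_sum partial_trace_B_cscale
        sum.cartesian_product X_def energy_gap_def case_prod_beta)
  have "infinite_time_average (subsystem_state H \<rho>) = (\<Sum>\<alpha> | \<alpha> \<in> ?I \<and> energy_gap E \<alpha> = 0. X \<alpha>)"
    unfolding state[abs_def] by (rule infinite_time_average_trig_sum) simp
  also have "\<dots> = (\<Sum>\<alpha> | \<alpha> \<in> ?I \<and> energy_gap E \<alpha> = 0. ?f \<alpha> t)"
    by (rule sum.cong) auto
  finally have avg: "infinite_time_average (subsystem_state H \<rho>) = \<dots>" .
  have gaps: "gap_indices d = ?I - {\<alpha> \<in> ?I. energy_gap E \<alpha> = 0}"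
    using E_eq_iff by (auto simp: gap_indices_def energy_gap_def)
  show ?thesis
    unfolding state avg gaps X_def[symmetric] by (rule sum_diff[symmetric]) auto
qed

lemma card_gaps_le_max_gap_count:
  "card {\<alpha> \<in> gap_indices d. energy_gap E \<alpha> \<in> {e..<e + \<epsilon>}} \<le> max_gap_count d E \<epsilon>"
proof -
  have fin: "finite (gap_indices d)"
    by (rule finite_subset[of _ "{1..d} \<times> {1..d}"]) (auto simp: gap_indices_def)
  have "range (\<lambda>e. card {\<alpha> \<in> gap_indices d. energy_gap E \<alpha> \<in> {e..<e + \<epsilon>}}) \<subseteq> {..card (gap_indices d)}"
    using fin by (auto intro!: card_mono)
  then show ?thesis
    unfolding max_gap_count_def by (intro Max_ge) (auto intro: finite_subset)
qed

lemma time_average_power2_le: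
  fixes f :: "real \<Rightarrow> real"
  assumes T: "T > 0" and f: "continuous_on {0..T} f"
  shows "(time_average f T)\<^sup>2 \<le> time_average (\<lambda>t. (f t)\<^sup>2) T"
proof -
  define m where "m = time_average f T"
  have "((\<lambda>t. (f t)\<^sup>2 - 2 * m * f t + m\<^sup>2) has_integral
      integral {0..T} (\<lambda>t. (f t)\<^sup>2) - 2 * m * integral {0..T} f + m\<^sup>2 * T) {0..T}"
    using has_integral_const_real[of "m\<^sup>2" 0 T] T
    by (intro has_integral_add has_integral_diff has_integral_mult_right integrable_integral
        integrable_continuous_interval continuous_intros f) (simp add: mult.commute)
  then have "0 \<le> integral {0..T} (\<lambda>t. (f t)\<^sup>2) - 2 * m * integral {0..T} f + m\<^sup>2 * T"
  proof (rule has_integral_nonneg)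
    fix t
    have "0 \<le> (f t - m)\<^sup>2" by simp
    then show "0 \<le> (f t)\<^sup>2 - 2 * m * f t + m\<^sup>2" by (simp add: power2_eq_square algebra_simps)
  qed
  moreover have "integral {0..T} f = m * T"
    using T by (simp add: m_def time_average_def)
  ultimately have "m\<^sup>2 * T \<le> integral {0..T} (\<lambda>t. (f t)\<^sup>2)"
    by (simp add: power2_eq_square algebra_simps)
  then show ?thesis
    unfolding m_def[symmetric] using T
    by (simp add: time_average_def pos_le_divide_eq divide_inverse_commute[symmetric] mult.commute)
qed

subsection \<open>Equilibration of the subsystem\<close>

theorem theorem8p3:
  fixes H \<rho>0 :: "complex ^ ('s::finite \<times> 'b::finite) ^ ('s \<times> 'b)"
    and d\<^sub>E :: nat
    and E :: "nat \<Rightarrow> real"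
    and P :: "nat \<Rightarrow> complex ^ ('s \<times> 'b) ^ ('s \<times> 'b)"
    and \<epsilon> T :: real
  assumes "hamiltonian_decomposition H d\<^sub>E E P"
    and "density_operator \<rho>0"
    and "\<epsilon> > 0"
    and "T > 0"
  shows "time_average
           (\<lambda>t. trace_distance (subsystem_state H \<rho>0 t)
                  (infinite_time_average (subsystem_state H \<rho>0))) T
         \<le> 1 / 2 * sqrt ((real CARD('s))\<^sup>2 / effective_dimension d\<^sub>E P \<rho>0
                * (5 * pi * real (max_gap_count d\<^sub>E E \<epsilon>) / 2)
                * (3 / 4 + 1 / (\<epsilon> * T)))"
proof -
  define \<omega> where "\<omega> = infinite_time_average (subsystem_state H \<rho>0)"
  define D where "D t = trace_distance (subsystem_state H \<rho>0 t) \<omega>" for t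
  define f where "f t = norm (subsystem_state H \<rho>0 t - \<omega>)" for t
  define C where "C = 5 * pi * real (max_gap_count d\<^sub>E E \<epsilon>) / 2 * (3 / 4 + 1 / (\<epsilon> * T))"
  define p2 where "p2 = (\<Sum>n=1..d\<^sub>E. (Re (trace (P n ** \<rho>0)))\<^sup>2)"
  define X where "X \<alpha> = partial_trace_B (P (fst \<alpha>) ** \<rho>0 ** P (snd \<alpha>))" for \<alpha>
  let ?A = "gap_indices d\<^sub>E" and ?s = "real CARD('s)"
  let ?g = "\<lambda>k l (t::real). (cmod (\<Sum>\<alpha>\<in>?A. X \<alpha> $ k $ l * exp (- \<i> * energy_gap E \<alpha> * t)))\<^sup>2"
  have psd: "positive_semidefinite \<rho>0"
    using assms(2) density_operator_def by blast
  have A: "?A \<subseteq> {1..d\<^sub>E} \<times> {1..d\<^sub>E}" by (auto simp: gap_indices_def)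
  then have fin: "finite ?A" by (rule finite_subset) simp
  have C: "C \<ge> 0" using assms(3,4) by (simp add: C_def)
  have p2: "p2 \<ge> 0" by (simp add: p2_def sum_nonneg)
  have dev: "subsystem_state H \<rho>0 t - \<omega> = (\<Sum>\<alpha>\<in>?A. cscale (exp (- \<i> * energy_gap E \<alpha> * t)) (X \<alpha>))" for t
    unfolding \<omega>_def X_def by (rule subsystem_state_deviation[OF assms(1)])
  have f_sq: "(f t)\<^sup>2 = (\<Sum>k\<in>UNIV. \<Sum>l\<in>UNIV. ?g k l t)" for t
    by (simp add: f_def dev matrix_norm_square mult.commute)
  have g_cont: "continuous_on S (?g k l)" for S k l
    by (intro continuous_intros)
  have "f = (\<lambda>t. sqrt (\<Sum>k\<in>UNIV. \<Sum>l\<in>UNIV. ?g k l t))"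
    unfolding f_sq[symmetric] by (simp add: f_def fun_eq_iff)
  then have f_cont: "continuous_on S f" for S
    by (simp only:) (intro continuous_intros)
  have "time_average (\<lambda>t. (f t)\<^sup>2) T = (\<Sum>k\<in>UNIV. \<Sum>l\<in>UNIV. integral {0..T} (?g k l) / T)"
  proof -
    have "((\<lambda>t. (f t)\<^sup>2) has_integral (\<Sum>k\<in>UNIV. \<Sum>l\<in>UNIV. integral {0..T} (?g k l))) {0..T}"
      unfolding f_sq
      by (intro has_integral_sum finite integrable_integral integrable_continuous_interval g_cont)
    then show ?thesis
      by (simp add: time_average_def integral_unique sum_divide_distrib divide_inverse sum_distrib_left mult.commute)
  qed
  also have "\<dots> \<le> (\<Sum>k\<in>UNIV. \<Sum>l\<in>UNIV. C * (\<Sum>\<alpha>\<in>?A. (cmod (X \<alpha> $ k $ l))\<^sup>2))"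
    unfolding C_def
    by (intro sum_mono trig_sum_time_average_le fin assms card_gaps_le_max_gap_count)
  also have "\<dots> = C * (\<Sum>\<alpha>\<in>?A. (norm (X \<alpha>))\<^sup>2)"
    unfolding matrix_norm_square
    by (simp only: sum_distrib_left sum.swap[of _ ?A UNIV])
  also have "(\<Sum>\<alpha>\<in>?A. (norm (X \<alpha>))\<^sup>2) \<le> (\<Sum>\<alpha>\<in>{1..d\<^sub>E} \<times> {1..d\<^sub>E}. (norm (X \<alpha>))\<^sup>2)"
    using A by (intro sum_mono2) auto
  also have "\<dots> = (\<Sum>i=1..d\<^sub>E. \<Sum>j=1..d\<^sub>E. (norm (partial_trace_B (P i ** \<rho>0 ** P j)))\<^sup>2)"
    by (simp add: sum.cartesian_product X_def case_prod_beta)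
  also have "\<dots> \<le> ?s * p2"
    unfolding p2_def by (rule sum_norm_partial_trace_le[OF assms(1) psd])
  finally have f_avg: "time_average (\<lambda>t. (f t)\<^sup>2) T \<le> C * (?s * p2)"
    using C by (simp add: mult_left_mono)
  \<comment> \<open>The integral of a non-integrable function is \<open>0\<close>, so measurability of \<open>D\<close> is not an issue.\<close>
  have "time_average D T \<le> sqrt ?s / 2 * sqrt (C * (?s * p2))"
  proof (cases "D integrable_on {0..T}")
    case True
    have "D t \<le> sqrt ?s / 2 * f t" for t
      using trace_distance_le_norm by (simp add: D_def f_def)
    then have "integral {0..T} D \<le> integral {0..T} (\<lambda>t. sqrt ?s / 2 * f t)"
      by (intro integral_le True integrable_continuous_interval continuous_on_mult_left f_cont)
    then have "time_average D T \<le> sqrt ?s / 2 * time_average f T"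
      using assms(4) by (simp add: time_average_def divide_right_mono field_simps)
    also have "time_average f T \<le> sqrt (C * (?s * p2))"
      using time_average_power2_le[OF assms(4) f_cont] f_avg by (intro real_le_rsqrt) linarith
    finally show ?thesis by (simp add: mult_left_mono)
  next
    case False
    then show ?thesis
      using C p2 by (simp add: time_average_def not_integrable_integral)
  qed
  also have "\<dots> = 1 / 2 * sqrt (?s * (C * (?s * p2)))"
    by (simp add: real_sqrt_mult)
  also have "?s * (C * (?s * p2)) = ?s\<^sup>2 / effective_dimension d\<^sub>E P \<rho>0
                * (5 * pi * real (max_gap_count d\<^sub>E E \<epsilon>) / 2) * (3 / 4 + 1 / (\<epsilon> * T))"
  proof -
    have eff: "effective_dimension d\<^sub>E P \<rho>0 = 1 / p2"
      by (simp add: effective_dimension_def p2_def)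
    show ?thesis unfolding eff C_def by (simp add: power2_eq_square)
  qed
  finally show ?thesis by (simp add: D_def[abs_def] \<omega>_def)
qed

end
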